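(* Let $q\ge 2$ be an integer. A positive Radon measure $\mu$ on $\mathbb{T}$ is the spectral measure of a branching-type stationary stochastic process on $T(q;1)$ if and only if $$\exp\left(\int_{\mathbb{T}}\log\Big(\frac{d\mu_{ac}}{dm}\Big)\,dm\right)\ \ge\ \Big(1-\frac1q\Big)\mu(\mathbb{T}),$$ where $\mu_{ac}$ is the absolutely continuous part of $\mu$ with respect to the normalized Haar measure $m$ on $\mathbb{T}$.
   Context: $\mathbb{N}=\{0,1,2,\dots\}$, $\mathbb{T}=\mathbb{R}/2\pi\mathbb{Z}$. $T(q;1)$ is the rooted tree whose root $e$ has exactly $q$ children and in which every other vertex has exactly one child (so it consists of $q$ infinite rays glued at the root). As usual $\exp(-\infty)=0$. For a rooted tree $T$ with root $e$, a rooted geodesic ray is an infinite geodesic $\xi=(\sigma_n)_{n\in\mathbb{N}}$ with $\sigma_0=e$; the set of these is $\partial T$, and each $\xi$ is identified with $\mathbb{N}$ via $\sigma_n\leftrightarrow n$. Two vertices are comparable if they lie on a common rooted geodesic ray. Random variables are complex-valued and, for mean-zero variables, $\mathrm{Cov}(X,Y)=\mathbb{E}(X\overline{Y})$. A mean-zero square-integrable process $(X_n)_{n\in\mathbb{N}}$ is (weakly) stationary if $\mathrm{Cov}(X_n,X_{n+k})$ does not depend on $n$, for all $n,k\in\mathbb{N}$; its spectral measure is the unique positive Radon measure $\nu$ on $\mathbb{T}$ with $\mathrm{Cov}(X_n,X_{n+k})=\int_{\mathbb{T}}e^{-ik\theta}d\nu(\theta)$ for all $n,k\in\mathbb{N}$.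 A mean-zero square-integrable process $(X_\sigma)_{\sigma\in T}$ (on some probability space) is a branching-type stationary stochastic process on $T$ if: (i) for every $\xi\in\partial T$, the restriction $(X_\sigma)_{\sigma\in\xi}$ is stationary; (ii) all these restrictions have the same spectral measure, which is called the spectral measure of the process; (iii) $\mathrm{Cov}(X_\sigma,X_\tau)=0$ for all non-comparable $\sigma,\tau\in T$. *)

theory Defs
  imports "HOL-Probability.Probability"
begin

section \<open>Measures on the circle\<close>

(* The circle R/2piZ is represented by its fundamental domain [0, 2pi), with the Borel sets of
   the line.  The quotient map R -> R/2piZ restricts to a Borel isomorphism of [0, 2pi) onto the
   circle, so both carry the same measures, although not the same topology; no topology of
   [0, 2pi) is used. *)
definition circle_borel :: "real measure" where
  "circle_borel = restrict_space borel {0..<2 * pi}"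

definition circle_haar :: "real measure" where
  "circle_haar = scale_measure (ennreal (1 / (2 * pi))) (restrict_space lborel {0..<2 * pi})"

(* The circle is compact and metrizable, so its positive Radon measures are exactly its finite
   positive Borel measures. *)
definition circle_measure :: "real measure \<Rightarrow> bool" where
  "circle_measure \<mu> \<longleftrightarrow> sets \<mu> = sets circle_borel \<and> finite_measure \<mu>"

lemma space_circle_borel [simp]: "space circle_borel = {0..<2 * pi}"
  by (simp add: circle_borel_def space_restrict_space)

lemma circle_measure_space: "circle_measure \<mu> \<Longrightarrow> space \<mu> = {0..<2 * pi}"
  using sets_eq_imp_space_eq[of \<mu> circle_borel] by (simp add: circle_measure_def)

lemma sets_circle_haar [simp]: "sets circle_haar = sets circle_borel"
  by (simp add: circle_haar_def circle_borel_def sets_restrict_space)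

lemma prob_space_circle_haar: "prob_space circle_haar"
proof
  have "emeasure circle_haar (space circle_haar) = ennreal (1 / (2 * pi)) * ennreal (2 * pi)"
    by (simp add: circle_haar_def space_restrict_space space_scale_measure emeasure_restrict_space)
  also have "\<dots> = 1"
    by (subst ennreal_mult[symmetric]) auto
  finally show "emeasure circle_haar (space circle_haar) = 1" .
qed

lemma circle_measure_haar: "circle_measure circle_haar"
proof -
  interpret prob_space circle_haar by (rule prob_space_circle_haar)
  show ?thesis by (simp add: circle_measure_def)
qed


section \<open>The absolutely continuous part\<close>

definition mutually_singular :: "'a measure \<Rightarrow> 'a measure \<Rightarrow> bool" where
  "mutually_singular m \<nu> \<longleftrightarrow> (\<exists>N \<in> sets m. emeasure m N = 0 \<and> emeasure \<nu> (space \<nu> - N) = 0)"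

definition lebesgue_decomposition ::
  "'a measure \<Rightarrow> 'a measure \<Rightarrow> 'a measure \<Rightarrow> 'a measure \<Rightarrow> bool" where
  "lebesgue_decomposition m \<mu> \<mu>ac \<mu>s \<longleftrightarrow>
     sets \<mu>ac = sets \<mu> \<and> sets \<mu>s = sets \<mu> \<and>
     (\<forall>A \<in> sets \<mu>. emeasure \<mu> A = emeasure \<mu>ac A + emeasure \<mu>s A) \<and>
     absolutely_continuous m \<mu>ac \<and> mutually_singular m \<mu>s"

definition ac_part :: "'a measure \<Rightarrow> 'a measure \<Rightarrow> 'a measure" where
  "ac_part m \<mu> = (THE \<mu>ac. \<exists>\<mu>s. lebesgue_decomposition m \<mu> \<mu>ac \<mu>s)"

lemma lebesgue_decomposition_exists:
  assumes "finite_measure \<mu>" and sets_eq: "sets \<mu> = sets m"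
  shows "\<exists>\<mu>ac \<mu>s. lebesgue_decomposition m \<mu> \<mu>ac \<mu>s"
proof -
  interpret finite_measure \<mu> by fact
  have "null_sets m \<noteq> {}" by auto
  from ennreal_SUP_countable_SUP[OF this, of "emeasure \<mu>"] obtain f :: "nat \<Rightarrow> ennreal"
    where f: "range f \<subseteq> emeasure \<mu> ` null_sets m"
      and fS: "(SUP N\<in>null_sets m. emeasure \<mu> N) = Sup (range f)"
    by auto
  from f have "\<forall>i. \<exists>N\<in>null_sets m. f i = emeasure \<mu> N" by auto
  then obtain F where F: "\<And>i. F i \<in> null_sets m" "\<And>i. f i = emeasure \<mu> (F i)" by metis
  define N where "N = (\<Union>i. F i)"
  have N: "N \<in> null_sets m" using F(1) by (auto simp: N_def)
  then have N_sets [measurable]: "N \<in> sets \<mu>" by (simp add: sets_eq null_setsD2)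
  have F_sets: "F i \<in> sets \<mu>" for i using F(1)[of i] by (simp add: sets_eq null_setsD2)
  have max: "emeasure \<mu> A \<le> emeasure \<mu> N" if "A \<in> null_sets m" for A
  proof -
    have "emeasure \<mu> A \<le> (SUP N\<in>null_sets m. emeasure \<mu> N)"
      using that by (rule SUP_upper)
    also have "\<dots> \<le> emeasure \<mu> N"
      unfolding fS by (rule SUP_least) (auto simp: F(2) N_def intro!: emeasure_mono F_sets)
    finally show ?thesis .
  qed
  define a where "a = density \<mu> (indicator (space \<mu> - N))"
  define s where "s = density \<mu> (indicator N)"
  have a: "emeasure a A = emeasure \<mu> (A - N)" if [measurable]: "A \<in> sets \<mu>" for A
  proof -
    have "emeasure a A = emeasure \<mu> ((space \<mu> - N) \<inter> A)"
      by (simp add: a_def emeasure_density indicator_inter_arith[symmetric])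
    also have "(space \<mu> - N) \<inter> A = A - N"
      using sets.sets_into_space[OF that] by auto
    finally show ?thesis .
  qed
  have s: "emeasure s A = emeasure \<mu> (A \<inter> N)" if [measurable]: "A \<in> sets \<mu>" for A
    by (simp add: s_def emeasure_density indicator_inter_arith[symmetric] Int_commute)
  have "lebesgue_decomposition m \<mu> a s"
    unfolding lebesgue_decomposition_def
  proof (intro conjI ballI)
    show "sets a = sets \<mu>" "sets s = sets \<mu>" by (simp_all add: a_def s_def)
    fix A assume A: "A \<in> sets \<mu>"
    have "emeasure \<mu> A = emeasure \<mu> ((A - N) \<union> (A \<inter> N))"
      by (rule arg_cong[of _ _ "emeasure \<mu>"]) auto
    also have "\<dots> = emeasure \<mu> (A - N) + emeasure \<mu> (A \<inter> N)"
      using A by (intro plus_emeasure[symmetric]) auto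
    finally show "emeasure \<mu> A = emeasure a A + emeasure s A" by (simp add: a s A)
  next
    show "absolutely_continuous m a"
      unfolding absolutely_continuous_def
    proof
      fix A assume A: "A \<in> null_sets m"
      then have As: "A \<in> sets \<mu>" by (simp add: sets_eq null_setsD2)
      have "emeasure \<mu> (A - N) + emeasure \<mu> N = emeasure \<mu> (A \<union> N)"
        using As by (subst plus_emeasure) auto
      also have "\<dots> \<le> emeasure \<mu> N" using A N by (intro max) auto
      finally have "emeasure \<mu> (A - N) = 0"
        using emeasure_finite[of N]
          ennreal_add_left_cancel_le[of "emeasure \<mu> N" "emeasure \<mu> (A - N)" 0]
        by (simp add: add.commute)
      then show "A \<in> null_sets a" using As by (simp add: null_sets_def a) (simp add: a_def)
    qed
    show "mutually_singular m s"
      unfolding mutually_singular_def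
    proof (intro bexI conjI)
      show "emeasure m N = 0" "N \<in> sets m" using N by (auto simp: null_sets_def)
      have "space s - N \<in> sets \<mu>" by (simp add: s_def)
      moreover have "(space s - N) \<inter> N = {}" by auto
      ultimately show "emeasure s (space s - N) = 0" by (simp add: s)
    qed
  qed
  then show ?thesis by blast
qed

lemma lebesgue_decomposition_unique:
  assumes "sets \<mu> = sets m"
    and 1: "lebesgue_decomposition m \<mu> a1 s1" and 2: "lebesgue_decomposition m \<mu> a2 s2"
  shows "a1 = a2"
proof -
  from 1 2 obtain N1 N2 where N: "N1 \<in> null_sets m" "N2 \<in> null_sets m"
      "emeasure s1 (space s1 - N1) = 0" "emeasure s2 (space s2 - N2) = 0"
    unfolding lebesgue_decomposition_def mutually_singular_def null_sets_def by auto
  have key: "emeasure a A = emeasure \<mu> (A - (N1 \<union> N2))"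
    if d: "lebesgue_decomposition m \<mu> a s" and K: "K \<in> {N1, N2}"
      "emeasure s (space s - K) = 0" and A: "A \<in> sets \<mu>" for a s K A
  proof -
    have sets: "sets a = sets \<mu>" "sets s = sets \<mu>"
      and ac: "absolutely_continuous m a"
      using d by (auto simp: lebesgue_decomposition_def)
    have NN: "N1 \<union> N2 \<in> null_sets m" using N by auto
    then have NNa: "N1 \<union> N2 \<in> null_sets a" using ac by (auto simp: absolutely_continuous_def)
    have B: "A - (N1 \<union> N2) \<in> sets \<mu>" using A NN assms(1) by (auto simp: null_setsD2)
    have "space s - K \<in> null_sets s"
      using K N sets assms(1) by (auto simp: null_sets_def)
    moreover have "A - (N1 \<union> N2) \<in> sets s" using B sets by simp
    moreover have "A - (N1 \<union> N2) \<subseteq> space s - K"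
      using K(1) sets.sets_into_space[OF A] sets_eq_imp_space_eq[OF sets(2)] by auto
    ultimately have "A - (N1 \<union> N2) \<in> null_sets s"
      by (rule null_sets_subset)
    then have "emeasure \<mu> (A - (N1 \<union> N2)) = emeasure a (A - (N1 \<union> N2))"
      using d B by (auto simp: lebesgue_decomposition_def)
    also have "\<dots> = emeasure a A"
      using NNa A sets by (intro emeasure_Diff_null_set) auto
    finally show ?thesis by simp
  qed
  show ?thesis
  proof (rule measure_eqI)
    show "sets a1 = sets a2" using 1 2 by (simp add: lebesgue_decomposition_def)
    fix A assume "A \<in> sets a1"
    then have "A \<in> sets \<mu>" using 1 by (simp add: lebesgue_decomposition_def)
    then show "emeasure a1 A = emeasure a2 A"
      using key[OF 1 _ N(3)] key[OF 2 _ N(4)] by simp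
  qed
qed

lemma lebesgue_decomposition_ac_part:
  assumes "finite_measure \<mu>" "sets \<mu> = sets m"
  shows "\<exists>\<mu>s. lebesgue_decomposition m \<mu> (ac_part m \<mu>) \<mu>s"
proof -
  have "\<exists>!a. \<exists>s. lebesgue_decomposition m \<mu> a s"
    using lebesgue_decomposition_exists[OF assms] lebesgue_decomposition_unique[OF assms(2)] by blast
  then show ?thesis unfolding ac_part_def by (rule theI')
qed


section \<open>Extended-valued logarithm, integral and exponential\<close>

definition ln_ennreal :: "ennreal \<Rightarrow> ereal" where
  "ln_ennreal x =
     (if x = 0 then - \<infinity> else if x = \<top> then \<infinity> else ereal (ln (enn2real x)))"

definition exp_ereal :: "ereal \<Rightarrow> ereal" where
  "exp_ereal x = (if x = - \<infinity> then 0 else if x = \<infinity> then \<infinity> else ereal (exp (real_of_ereal x)))"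

(* Integral of the positive part minus integral of the negative part; meaningful unless both are
   infinite.  For the logarithm of the density of a finite measure the first one is finite, since
   max 0 (ln x) \<le> x. *)
definition ereal_integral :: "'a measure \<Rightarrow> ('a \<Rightarrow> ereal) \<Rightarrow> ereal" where
  "ereal_integral M f =
     enn2ereal (\<integral>\<^sup>+x. e2ennreal (f x) \<partial>M) - enn2ereal (\<integral>\<^sup>+x. e2ennreal (- f x) \<partial>M)"


section \<open>Rooted trees\<close>

(* An undirected graph is given by a symmetric set of ordered pairs of vertices. *)
record 'v rooted_graph =
  verts :: "'v set"
  edges :: "('v \<times> 'v) set"
  root :: 'v

definition rooted_tree :: "'v rooted_graph \<Rightarrow> bool" where
  "rooted_tree T \<longleftrightarrow>
     root T \<in> verts T \<and> edges T \<subseteq> verts T \<times> verts T \<and> sym (edges T) \<and> irrefl (edges T) \<and>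
     (\<forall>u \<in> verts T. \<forall>v \<in> verts T. (u, v) \<in> (edges T)\<^sup>*) \<and>
     \<not> (\<exists>k \<ge> 3. \<exists>c :: nat \<Rightarrow> 'v.
          inj_on c {..<k} \<and> (\<forall>i < k. (c i, c (Suc i mod k)) \<in> edges T))"

definition graph_dist :: "'v rooted_graph \<Rightarrow> 'v \<Rightarrow> 'v \<Rightarrow> nat" where
  "graph_dist T u v = (LEAST n. (u, v) \<in> edges T ^^ n)"

definition children :: "'v rooted_graph \<Rightarrow> 'v \<Rightarrow> 'v set" where
  "children T v =
     {w \<in> verts T. (v, w) \<in> edges T \<and> graph_dist T (root T) w = Suc (graph_dist T (root T) v)}"

definition rays :: "'v rooted_graph \<Rightarrow> (nat \<Rightarrow> 'v) set" where
  "rays T = {\<xi>. \<xi> 0 = root T \<and> range \<xi> \<subseteq> verts T \<and>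
                 (\<forall>m n. m \<le> n \<longrightarrow> graph_dist T (\<xi> m) (\<xi> n) = n - m)}"

definition comparable :: "'v rooted_graph \<Rightarrow> 'v \<Rightarrow> 'v \<Rightarrow> bool" where
  "comparable T \<sigma> \<tau> \<longleftrightarrow> (\<exists>\<xi> \<in> rays T. \<sigma> \<in> range \<xi> \<and> \<tau> \<in> range \<xi>)"


section \<open>The tree of rays glued at the root\<close>

(* T(q;1): None is the root and Some (i, n) is the vertex at distance n + 1 from the root on the
   i-th ray.  The lemmas below show that this is a rooted tree whose root has exactly q children
   and whose other vertices have exactly one child. *)
definition glued_rays_arcs :: "nat \<Rightarrow> ((nat \<times> nat) option \<times> (nat \<times> nat) option) set" where
  "glued_rays_arcs q = {(None, Some (i, 0)) | i. i < q} \<union>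
                       {(Some (i, n), Some (i, Suc n)) | i n. i < q}"

definition glued_rays :: "nat \<Rightarrow> (nat \<times> nat) option rooted_graph" where
  "glued_rays q =
     \<lparr>verts = insert None (Some ` ({..<q} \<times> UNIV)),
      edges = glued_rays_arcs q \<union> (glued_rays_arcs q)\<inverse>,
      root = None\<rparr>"

lemma glued_rays_simps:
  "verts (glued_rays q) = insert None (Some ` ({..<q} \<times> UNIV))"
  "edges (glued_rays q) = glued_rays_arcs q \<union> (glued_rays_arcs q)\<inverse>"
  "root (glued_rays q) = None"
  by (simp_all add: glued_rays_def)

lemma graph_dist_root_glued_rays:
  "graph_dist (glued_rays q) None None = 0"
  "i < q \<Longrightarrow> graph_dist (glued_rays q) None (Some (i, n)) = Suc n"
proof -
  define depth :: "(nat \<times> nat) option \<Rightarrow> nat"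
    where "depth v = (case v of None \<Rightarrow> 0 | Some (i, n) \<Rightarrow> Suc n)" for v
  have step: "depth v \<le> Suc (depth u)" if "(u, v) \<in> edges (glued_rays q)" for u v
    using that by (auto simp: glued_rays_def glued_rays_arcs_def depth_def)
  have le: "depth v \<le> n" if "(None, v) \<in> edges (glued_rays q) ^^ n" for n v
    using that
  proof (induction n arbitrary: v)
    case 0
    then show ?case by (simp add: depth_def)
  next
    case (Suc n)
    then show ?case using step le_trans not_less_eq_eq by (auto, fastforce)
  qed
  show "graph_dist (glued_rays q) None None = 0"
    unfolding graph_dist_def by (rule Least_eq_0) simp
  assume i: "i < q"
  have reach: "(None, Some (i, n)) \<in> edges (glued_rays q) ^^ Suc n" for n
  proof (induction n)
    case 0
    then show ?case using i by (auto simp: glued_rays_def glued_rays_arcs_def)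
  next
    case (Suc n)
    have "(Some (i, n), Some (i, Suc n)) \<in> edges (glued_rays q)"
      using i by (auto simp: glued_rays_def glued_rays_arcs_def)
    with Suc show ?case by (metis relpow_Suc_I)
  qed
  show "graph_dist (glued_rays q) None (Some (i, n)) = Suc n"
    unfolding graph_dist_def
  proof (rule Least_equality)
    show "(None, Some (i, n)) \<in> edges (glued_rays q) ^^ Suc n" by (rule reach)
  next
    fix k assume "(None, Some (i, n)) \<in> edges (glued_rays q) ^^ k"
    from le[OF this] show "Suc n \<le> k" by (simp add: depth_def)
  qed
qed

lemma children_glued_rays:
  "card (children (glued_rays q) (root (glued_rays q))) = q"
  "v \<in> verts (glued_rays q) \<Longrightarrow> v \<noteq> root (glued_rays q) \<Longrightarrow> card (children (glued_rays q) v) = 1"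
proof -
  have "children (glued_rays q) (root (glued_rays q)) = (\<lambda>i. Some (i, 0)) ` {..<q}"
    by (auto simp: children_def glued_rays_simps glued_rays_arcs_def graph_dist_root_glued_rays)
  then show "card (children (glued_rays q) (root (glued_rays q))) = q"
    by (simp add: card_image inj_on_def)
  assume "v \<in> verts (glued_rays q)" "v \<noteq> root (glued_rays q)"
  then obtain i n where v: "v = Some (i, n)" and i: "i < q"
    by (auto simp: glued_rays_def)
  have "children (glued_rays q) v = {Some (i, Suc n)}"
    using i by (auto simp: v children_def glued_rays_simps glued_rays_arcs_def graph_dist_root_glued_rays)
  then show "card (children (glued_rays q) v) = 1" by simp
qed

lemma rooted_tree_glued_rays: "rooted_tree (glued_rays q)"
proof -
  let ?E = "edges (glued_rays q)"
  have sym: "sym ?E" by (auto simp: glued_rays_def sym_def)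
  have root_conn: "(None, v) \<in> ?E\<^sup>*" if "v \<in> verts (glued_rays q)" for v
  proof (cases v)
    case (Some p)
    obtain i n where p: "p = (i, n)" by force
    have i: "i < q" using that by (auto simp: Some p glued_rays_def)
    have "(None, Some (i, n)) \<in> ?E\<^sup>*"
    proof (induction n)
      case 0
      show ?case using i by (intro r_into_rtrancl) (auto simp: glued_rays_def glued_rays_arcs_def)
    next
      case (Suc n)
      have "(Some (i, n), Some (i, Suc n)) \<in> ?E"
        using i by (auto simp: glued_rays_def glued_rays_arcs_def)
      with Suc show ?case by (rule rtrancl_into_rtrancl)
    qed
    then show ?thesis by (simp add: Some p)
  qed simp
  define depth :: "(nat \<times> nat) option \<Rightarrow> nat"
    where "depth v = (case v of None \<Rightarrow> 0 | Some (i, n) \<Rightarrow> Suc n)" for v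
  have parent: "u = w" if "(u, v) \<in> ?E" "(v, w) \<in> ?E" "depth u \<le> depth v" "depth w \<le> depth v"
    for u v w
    using that by (auto simp: glued_rays_def glued_rays_arcs_def depth_def)
  have acyclic: False
    if k: "3 \<le> k" and c: "inj_on c {..<k}" and e: "\<And>i. i < k \<Longrightarrow> (c i, c (Suc i mod k)) \<in> ?E"
    for k :: nat and c
  proof -
    obtain j where j: "j < k" and max: "\<And>i. i < k \<Longrightarrow> depth (c i) \<le> depth (c j)"
    proof -
      have "Max ((\<lambda>i. depth (c i)) ` {..<k}) \<in> (\<lambda>i. depth (c i)) ` {..<k}"
        using k by (intro Max_in) (auto simp: lessThan_empty_iff)
      then obtain j where "j < k" "Max ((\<lambda>i. depth (c i)) ` {..<k}) = depth (c j)" by auto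
      then show ?thesis by (intro that[of j]) (auto intro: Max_ge simp flip: \<open>_ = depth (c j)\<close>)
    qed
    define p where "p = (if j = 0 then k - 1 else j - 1)"
    have p: "p < k" "Suc p mod k = j" using k j by (auto simp: p_def)
    have s: "Suc j mod k < k" using k by simp
    have "c p = c (Suc j mod k)"
      using parent[of "c p" "c j" "c (Suc j mod k)"] e[OF p(1)] e[OF j] p max[OF p(1)] max[OF s]
      by simp
    then have "p = Suc j mod k" using c p s by (auto simp: inj_on_def)
    moreover have "Suc j mod k = (if Suc j = k then 0 else Suc j)" using j by auto
    ultimately show False using k j by (auto simp: p_def split: if_splits)
  qed
  show ?thesis
    unfolding rooted_tree_def
  proof (intro conjI ballI)
    show "root (glued_rays q) \<in> verts (glued_rays q)" by (simp add: glued_rays_def)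
    show "?E \<subseteq> verts (glued_rays q) \<times> verts (glued_rays q)"
      by (auto simp: glued_rays_def glued_rays_arcs_def)
    show "irrefl ?E" by (auto simp: glued_rays_def glued_rays_arcs_def irrefl_def)
    show "(u, v) \<in> ?E\<^sup>*" if "u \<in> verts (glued_rays q)" "v \<in> verts (glued_rays q)" for u v
      using root_conn[OF that(1)] root_conn[OF that(2)] sym_rtrancl[OF sym]
      by (meson rtrancl_trans symD)
    show "\<not> (\<exists>k \<ge> 3. \<exists>c :: nat \<Rightarrow> (nat \<times> nat) option.
          inj_on c {..<k} \<and> (\<forall>i < k. (c i, c (Suc i mod k)) \<in> ?E))"
      using acyclic by blast
  qed (rule sym)
qed


section \<open>Stationary and branching-type stationary processes\<close>

definition mean_zero_L2_process :: "'w measure \<Rightarrow> 'i set \<Rightarrow> ('i \<Rightarrow> 'w \<Rightarrow> complex) \<Rightarrow> bool" where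
  "mean_zero_L2_process M I X \<longleftrightarrow> prob_space M \<and>
     (\<forall>i \<in> I. X i \<in> borel_measurable M \<and> integrable M (\<lambda>\<omega>. (cmod (X i \<omega>))\<^sup>2) \<and>
              (\<integral>\<omega>. X i \<omega> \<partial>M) = 0)"

definition cov :: "'w measure \<Rightarrow> ('w \<Rightarrow> complex) \<Rightarrow> ('w \<Rightarrow> complex) \<Rightarrow> complex" where
  "cov M X Y = (\<integral>\<omega>. X \<omega> * cnj (Y \<omega>) \<partial>M)"

definition stationary :: "'w measure \<Rightarrow> (nat \<Rightarrow> 'w \<Rightarrow> complex) \<Rightarrow> bool" where
  "stationary M X \<longleftrightarrow> mean_zero_L2_process M UNIV X \<and>
     (\<forall>k n n'. cov M (X n) (X (n + k)) = cov M (X n') (X (n' + k)))"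

definition is_spectral_measure :: "'w measure \<Rightarrow> (nat \<Rightarrow> 'w \<Rightarrow> complex) \<Rightarrow> real measure \<Rightarrow> bool" where
  "is_spectral_measure M X \<nu> \<longleftrightarrow> circle_measure \<nu> \<and>
     (\<forall>n k. cov M (X n) (X (n + k)) = (\<integral>\<theta>. exp (- \<i> * of_nat k * of_real \<theta>) \<partial>\<nu>))"

definition branching_type_stationary ::
  "'w measure \<Rightarrow> 'v rooted_graph \<Rightarrow> ('v \<Rightarrow> 'w \<Rightarrow> complex) \<Rightarrow> bool" where
  "branching_type_stationary M T X \<longleftrightarrow> mean_zero_L2_process M (verts T) X \<and>
     (\<forall>\<xi> \<in> rays T. stationary M (\<lambda>n. X (\<xi> n))) \<and>
     (\<exists>\<nu>. \<forall>\<xi> \<in> rays T. is_spectral_measure M (\<lambda>n. X (\<xi> n)) \<nu>) \<and>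
     (\<forall>\<sigma> \<in> verts T. \<forall>\<tau> \<in> verts T. \<not> comparable T \<sigma> \<tau> \<longrightarrow> cov M (X \<sigma>) (X \<tau>) = 0)"

definition is_process_spectral_measure ::
  "'w measure \<Rightarrow> 'v rooted_graph \<Rightarrow> ('v \<Rightarrow> 'w \<Rightarrow> complex) \<Rightarrow> real measure \<Rightarrow> bool" where
  "is_process_spectral_measure M T X \<mu> \<longleftrightarrow>
     branching_type_stationary M T X \<and> (\<forall>\<xi> \<in> rays T. is_spectral_measure M (\<lambda>n. X (\<xi> n)) \<mu>)"

(* HOL cannot quantify over the type of the sample points of the underlying probability space.
   The points are taken in the path space (functions from vertices to complex numbers), which
   loses nothing: a process on any probability space has the same law as the coordinate process
   on path space under the image measure (see the next lemma). *)
definition spectral_measure_of_branching_process :: "'v rooted_graph \<Rightarrow> real measure \<Rightarrow> bool" where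
  "spectral_measure_of_branching_process T \<mu> \<longleftrightarrow>
     (\<exists>(M :: ('v \<Rightarrow> complex) measure) X. is_process_spectral_measure M T X \<mu>)"

lemma spectral_measure_of_branching_processI:
  fixes M :: "'w measure" and T :: "'v rooted_graph"
  assumes "is_process_spectral_measure M T X \<mu>"
  shows "spectral_measure_of_branching_process T \<mu>"
proof -
  let ?V = "verts T"
  define P where "P = Pi\<^sub>M ?V (\<lambda>_. borel :: complex measure)"
  define f where "f = (\<lambda>\<omega>. \<lambda>v\<in>?V. X v \<omega>)"
  define M' where "M' = distr M P f"
  define Y where "Y = (\<lambda>v (x :: 'v \<Rightarrow> complex). x v)"
  have L2: "mean_zero_L2_process M ?V X"
    using assms by (simp add: is_process_spectral_measure_def branching_type_stationary_def)
  then have X [measurable]: "\<And>v. v \<in> ?V \<Longrightarrow> X v \<in> borel_measurable M"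
    by (simp add: mean_zero_L2_process_def)
  have f [measurable]: "f \<in> measurable M P"
    unfolding f_def P_def by (rule measurable_restrict) (rule X)
  have Y [measurable]: "Y v \<in> borel_measurable P" if "v \<in> ?V" for v
    unfolding Y_def P_def using that by (rule measurable_component_singleton)
  have Yf: "Y v (f \<omega>) = X v \<omega>" if "v \<in> ?V" for v \<omega>
    using that by (simp add: Y_def f_def)
  have L2': "mean_zero_L2_process M' ?V Y"
    unfolding mean_zero_L2_process_def
  proof (intro conjI ballI)
    show "prob_space M'"
      unfolding M'_def using L2 by (intro prob_space.prob_space_distr f)
        (simp add: mean_zero_L2_process_def)
    fix v assume v: "v \<in> ?V"
    note [measurable] = Y[OF v]
    show "Y v \<in> borel_measurable M'" by (simp add: M'_def v)
    show "integrable M' (\<lambda>\<omega>. (cmod (Y v \<omega>))\<^sup>2)"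
      using L2 v unfolding M'_def
      by (subst integrable_distr_eq) (auto simp: Yf mean_zero_L2_process_def)
    show "(\<integral>\<omega>. Y v \<omega> \<partial>M') = 0"
      using L2 v unfolding M'_def
      by (subst integral_distr) (auto simp: Yf mean_zero_L2_process_def)
  qed
  have cov: "cov M' (Y u) (Y v) = cov M (X u) (X v)" if "u \<in> ?V" "v \<in> ?V" for u v
  proof -
    have "(\<lambda>\<omega>. Y u \<omega> * cnj (Y v \<omega>)) \<in> borel_measurable P"
      using Y[OF that(1)] Y[OF that(2)]
      by (intro borel_measurable_times borel_measurable_continuous_on[of cnj] continuous_intros)
    note [measurable] = this
    show ?thesis unfolding cov_def M'_def
      by (subst integral_distr) (auto simp: Yf that)
  qed
  have ray: "\<xi> n \<in> ?V" if "\<xi> \<in> rays T" for \<xi> n using that by (auto simp: rays_def)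
  have spec: "is_spectral_measure M' (\<lambda>n. Y (\<xi> n)) \<nu> \<longleftrightarrow> is_spectral_measure M (\<lambda>n. X (\<xi> n)) \<nu>"
    if "\<xi> \<in> rays T" for \<xi> \<nu>
    by (simp add: is_spectral_measure_def cov ray[OF that])
  have stat: "stationary M' (\<lambda>n. Y (\<xi> n))"
    if r: "\<xi> \<in> rays T" and s: "stationary M (\<lambda>n. X (\<xi> n))" for \<xi>
    using s L2' by (simp add: stationary_def cov ray[OF r] mean_zero_L2_process_def)
  have "is_process_spectral_measure M' T Y \<mu>"
    using assms L2' unfolding is_process_spectral_measure_def branching_type_stationary_def
    by (auto simp: spec cov stat)
  then show ?thesis unfolding spectral_measure_of_branching_process_def by blast
qed

end

theory Submission
  imports Defs "HOL-Computational_Algebra.Polynomial"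
begin

text \<open>
  Write \<open>z = e\<^sup>i\<^sup>\<theta>\<close>, \<open>m\<close> for Haar measure and \<open>c = \<mu>(T)\<close>.  In \<open>L\<^sup>2(\<mu>)\<close> the powers
  \<open>1, z, z\<^sup>2, \<dots>\<close> have the covariances that a branching-type process with spectral measure
  \<open>\<mu>\<close> has along each ray, and between different branches the covariances vanish.  So \<open>\<mu>\<close> determines a kernel on
  the vertices, and \<open>\<mu>\<close> is a spectral measure if and only if this kernel is positive semidefinite
  (\<open>spectral_measure_iff_psd_kernel\<close>): every such kernel on a countable set is a covariance, by
  Cholesky factorization against the orthonormal sequence \<open>z, z\<^sup>2, \<dots>\<close> in \<open>L\<^sup>2(m)\<close>.

  Let finitely many coefficients be given on the tree.  On each of the \<open>q\<close> rays they form a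
  polynomial \<open>P\<^sub>i\<close>, and the polynomials share the constant term \<open>a\<close>, the coefficient of the root.
  The rays meet only in the root, so the quadratic form is
  \<open>\<Sum>\<^sub>i \<integral> |P\<^sub>i|\<^sup>2 d\<mu> - (q - 1) c |a|\<^sup>2\<close> (\<open>branching_kernel_form\<close>).  The rays do not interact, hence
  the form is nonnegative if and only if \<open>\<integral> |P|\<^sup>2 d\<mu> \<ge> (1 - 1/q) c\<close> for every polynomial \<open>P\<close> with
  \<open>P(0) = 1\<close> (\<open>psd_branching_kernel_iff\<close>).  In probabilistic terms this is Bessel's inequality:
  the root has \<open>q\<close> orthogonal projections of equal norm, one on each ray without its root.

  It remains to know the infimum of \<open>\<integral> |P|\<^sup>2 d\<mu>\<close>, which is \<open>exp (\<integral> log w dm)\<close> for the density \<open>w\<close>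
  of the absolutely continuous part; this is the theorem of Szego, Kolmogorov and Verblunsky
  (\<open>szego\<close>).  Both of its inequalities come from one principle.  Let \<open>s \<le> \<integral> |Q|\<^sup>2 d\<nu>\<close> whenever
  \<open>Q(0) = 1\<close>.  If \<open>G\<close> is a polynomial with \<open>G(0) = 0\<close>, then the Taylor polynomials of
  \<open>P exp (G/2)\<close> in \<open>G\<close> also have the value \<open>1\<close> at \<open>0\<close>, so in the limit
  \<open>s \<le> \<integral> |P|\<^sup>2 exp (Re G) d\<nu>\<close>.  Bounded Borel functions are limits of functions \<open>Re G\<close>, in
  \<open>L\<^sup>1(\<nu>)\<close> and \<open>L\<^sup>1(m)\<close> at once, which gives
  \<open>s exp (\<integral> h dm) \<le> \<integral> |P|\<^sup>2 exp h d\<nu>\<close> for every bounded Borel \<open>h\<close> (\<open>szego_bound_exp_borel\<close>).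
  For \<open>\<nu> = m\<close>, \<open>s = 1\<close> and \<open>h\<close> a truncation of \<open>log w\<close> this is the lower bound for
  \<open>\<integral> |P|\<^sup>2 d\<mu>\<close>.  For \<open>\<nu> = \<mu>\<close>, \<open>P = 1\<close>, and \<open>h\<close> a truncation of \<open>- log w\<close> that is made very negative on
  a Haar null set carrying the singular part, it says that no number above the geometric mean is
  a lower bound.
\<close>


section \<open>Positive semidefinite kernels and the Cholesky factorization\<close>

text \<open>Hermitian symmetry is a separate clause; it makes the form real, so that the positivity
  clause may speak of real parts.\<close>

definition psd_kernel :: "('i \<Rightarrow> 'i \<Rightarrow> complex) \<Rightarrow> bool" where
  "psd_kernel K \<longleftrightarrow> (\<forall>u v. K v u = cnj (K u v)) \<and>
     (\<forall>S a. finite S \<longrightarrow> 0 \<le> Re (\<Sum>u\<in>S. \<Sum>v\<in>S. a u * cnj (a v) * K u v))"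

lemma psd_kernel_herm: "psd_kernel K \<Longrightarrow> cnj (K u v) = K v u"
  unfolding psd_kernel_def by metis

lemma psd_kernel_form:
  "psd_kernel K \<Longrightarrow> finite S \<Longrightarrow> 0 \<le> Re (\<Sum>u\<in>S. \<Sum>v\<in>S. a u * cnj (a v) * K u v)"
  unfolding psd_kernel_def by blast

lemma psd_kernel_diag:
  assumes "psd_kernel K"
  shows "K j j = complex_of_real (Re (K j j))" and "0 \<le> Re (K j j)"
proof -
  have "Im (K j j) = 0" using psd_kernel_herm[OF assms, of j j] by (simp add: complex_eq_iff)
  then show "K j j = complex_of_real (Re (K j j))" by (simp add: complex_eq_iff)
  show "0 \<le> Re (K j j)" using psd_kernel_form[OF assms, of "{j}" "\<lambda>_. 1"] by simp
qed

text \<open>Adding \<open>t\<close> to the coefficient at one index changes the form by a quadratic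
  polynomial in \<open>t\<close>.  Good choices of \<open>t\<close> give the Cauchy-Schwarz inequality for \<open>K\<close> and the
  positivity of Schur complements.\<close>

lemma psd_kernel_shift:
  fixes a :: "'i \<Rightarrow> complex" and j :: 'i
  assumes K: "psd_kernel K" and S: "finite S"
  defines "T \<equiv> (\<Sum>u\<in>S. a u * K u j)"
  shows "0 \<le> Re (\<Sum>u\<in>S. \<Sum>v\<in>S. a u * cnj (a v) * K u v) + 2 * Re (cnj t * T) + (cmod t)\<^sup>2 * Re (K j j)"
proof -
  define S' where "S' = insert j S"
  define a' where "a' = (\<lambda>u. if u \<in> S then a u else 0)"
  define b where "b = (\<lambda>u. if u = j then t else 0)"
  have fS': "finite S'" "S \<subseteq> S'" "j \<in> S'" using S by (auto simp: S'_def)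
  have 1: "(\<Sum>u\<in>S'. a' u * f u) = (\<Sum>u\<in>S. a u * f u)" for f
    by (rule sum.mono_neutral_cong_right) (use fS' in \<open>auto simp: a'_def\<close>)
  have 2: "(\<Sum>u\<in>S'. cnj (a' u) * f u) = (\<Sum>u\<in>S. cnj (a u) * f u)" for f
    by (rule sum.mono_neutral_cong_right) (use fS' in \<open>auto simp: a'_def\<close>)
  have 3: "(\<Sum>u\<in>S'. b u * f u) = t * f j" for f
    using fS' by (simp add: b_def if_distrib[of "\<lambda>x. x * _"] sum.delta cong: if_cong)
  have 4: "(\<Sum>u\<in>S'. cnj (b u) * f u) = cnj t * f j" for f
    using fS' by (simp add: b_def if_distrib[of "\<lambda>x. x * _"] if_distrib[of cnj] sum.delta cong: if_cong)
  have "(\<Sum>u\<in>S'. \<Sum>v\<in>S'. (a' u + b u) * cnj (a' v + b v) * K u v)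
      = (\<Sum>u\<in>S'. a' u * (\<Sum>v\<in>S'. cnj (a' v) * K u v)) + (\<Sum>u\<in>S'. a' u * (\<Sum>v\<in>S'. cnj (b v) * K u v))
       + (\<Sum>u\<in>S'. b u * (\<Sum>v\<in>S'. cnj (a' v) * K u v)) + (\<Sum>u\<in>S'. b u * (\<Sum>v\<in>S'. cnj (b v) * K u v))"
    by (simp add: algebra_simps sum.distrib sum_distrib_left)
  also have "\<dots> = (\<Sum>u\<in>S. \<Sum>v\<in>S. a u * cnj (a v) * K u v) + cnj t * T + t * cnj T + t * cnj t * K j j"
    unfolding 1 2 3 4 T_def
    by (simp add: sum_distrib_left algebra_simps psd_kernel_herm[OF K])
  finally have eq: "(\<Sum>u\<in>S'. \<Sum>v\<in>S'. (a' u + b u) * cnj (a' v + b v) * K u v)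
     = (\<Sum>u\<in>S. \<Sum>v\<in>S. a u * cnj (a v) * K u v) + cnj t * T + t * cnj T + t * cnj t * K j j" .
  have "Re (t * cnj T) = Re (cnj t * T)" by (simp add: algebra_simps)
  moreover have "Re (t * cnj t * K j j) = (cmod t)\<^sup>2 * Re (K j j)"
    unfolding complex_norm_square[symmetric] by (simp del: of_real_power)
  ultimately show ?thesis
    using psd_kernel_form[OF K fS'(1), of "\<lambda>u. a' u + b u"] by (simp only: eq plus_complex.sel)
qed

text \<open>If \<open>K j j = 0\<close>, the polynomial in \<open>t\<close> of the preceding lemma is affine, and
  it is bounded below only if its slope vanishes.\<close>

lemma psd_kernel_zero_column:
  assumes K: "psd_kernel K" and "K j j = 0"
  shows "K n j = 0" "K j n = 0"
proof -
  show "K n j = 0"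
  proof (rule ccontr)
    assume n: "K n j \<noteq> 0"
    \<comment> \<open>chosen so that the affine function takes the value \<open>- 1\<close>\<close>
    define r where "r = - (Re (K n n) + 1) / (2 * (cmod (K n j))\<^sup>2)"
    have "0 \<le> Re (K n n) + 2 * Re (cnj (of_real r * K n j) * K n j)"
      using psd_kernel_shift[OF K, where S = "{n}" and a = "\<lambda>_. 1" and t = "of_real r * K n j" and j = j] assms(2) by simp
    also have "Re (cnj (of_real r * K n j) * K n j) = r * (cmod (K n j))\<^sup>2"
      unfolding cmod_power2 by (simp add: power2_eq_square algebra_simps)
    also have "Re (K n n) + 2 * (r * (cmod (K n j))\<^sup>2) = -1"
      using n by (simp add: r_def field_simps)
    finally show False by simp
  qed
  then show "K j n = 0" using psd_kernel_herm[OF K, of n j] by simp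
qed

text \<open>If \<open>K j j = 0\<close>, the quotient is \<open>0\<close> and \<open>K\<close> is unchanged; this is the right
  value, because row and column \<open>j\<close> then vanish already.\<close>

definition schur_complement :: "('i \<Rightarrow> 'i \<Rightarrow> complex) \<Rightarrow> 'i \<Rightarrow> 'i \<Rightarrow> 'i \<Rightarrow> complex" where
  "schur_complement K j = (\<lambda>n m. K n m - K n j * K j m / K j j)"

lemma schur_complement_zero:
  assumes "psd_kernel K"
  shows "schur_complement K j j m = 0" "schur_complement K j n j = 0"
proof -
  have "K j m = 0" "K n j = 0" if "K j j = 0"
    using psd_kernel_zero_column[OF assms that] by auto
  then show "schur_complement K j j m = 0" "schur_complement K j n j = 0"
    by (cases "K j j = 0"; simp add: schur_complement_def)+
qed

text \<open>The form of the Schur complement is the minimum of the form of \<open>K\<close> over the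
  coefficient at \<open>j\<close>.\<close>

lemma psd_kernel_schur_complement:
  fixes K :: "'i \<Rightarrow> 'i \<Rightarrow> complex"
  assumes K: "psd_kernel K"
  shows "psd_kernel (schur_complement K j)"
  unfolding psd_kernel_def
proof (intro conjI allI impI)
  note herm = psd_kernel_herm[OF K]
  show "schur_complement K j v u = cnj (schur_complement K j u v)" for u v
    by (simp add: schur_complement_def herm mult.commute)
  fix S :: "'i set" and a :: "'i \<Rightarrow> complex" assume S: "finite S"
  define d where "d = Re (K j j)"
  have d: "K j j = of_real d" "0 \<le> d" using psd_kernel_diag[OF K, of j] by (simp_all add: d_def)
  define T where "T = (\<Sum>u\<in>S. a u * K u j)"
  have cT: "cnj T = (\<Sum>v\<in>S. cnj (a v) * K j v)" by (simp add: T_def herm)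
  have "(\<Sum>u\<in>S. \<Sum>v\<in>S. a u * cnj (a v) * schur_complement K j u v)
      = (\<Sum>u\<in>S. \<Sum>v\<in>S. a u * cnj (a v) * K u v) - T * cnj T / of_real d"
    unfolding cT unfolding T_def schur_complement_def d
    by (simp add: sum_product sum_subtractf sum_divide_distrib algebra_simps)
  also have "T * cnj T / of_real d = of_real ((cmod T)\<^sup>2 / d)"
    by (simp add: complex_norm_square del: of_real_power)
  finally have eq: "Re (\<Sum>u\<in>S. \<Sum>v\<in>S. a u * cnj (a v) * schur_complement K j u v)
      = Re (\<Sum>u\<in>S. \<Sum>v\<in>S. a u * cnj (a v) * K u v) - (cmod T)\<^sup>2 / d"
    by simp
  \<comment> \<open>the minimizing coefficient at \<open>j\<close> is \<open>- T / d\<close>\<close>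
  have "0 \<le> Re (\<Sum>u\<in>S. \<Sum>v\<in>S. a u * cnj (a v) * K u v) + 2 * Re (cnj (- T / of_real d) * T)
      + (cmod (- T / of_real d))\<^sup>2 * d"
    using psd_kernel_shift[OF K S, where a = a and j = j and t = "- T / of_real d"] by (simp only: T_def d_def)
  also have "Re (cnj (- T / of_real d) * T) = - (cmod T)\<^sup>2 / d"
    unfolding cmod_power2 by (simp add: power2_eq_square algebra_simps add_divide_distrib diff_divide_distrib)
  also have "(cmod (- T / of_real d))\<^sup>2 * d = (cmod T)\<^sup>2 / d"
    using d(2) by (simp add: norm_divide power2_eq_square)
  finally show "0 \<le> Re (\<Sum>u\<in>S. \<Sum>v\<in>S. a u * cnj (a v) * schur_complement K j u v)"
    unfolding eq by simp
qed

text \<open>What remains of \<open>K\<close> after the indices below \<open>j\<close> have been eliminated.\<close>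

primrec cholesky_rest :: "(nat \<Rightarrow> nat \<Rightarrow> complex) \<Rightarrow> nat \<Rightarrow> nat \<Rightarrow> nat \<Rightarrow> complex" where
  "cholesky_rest K 0 = K"
| "cholesky_rest K (Suc j) = schur_complement (cholesky_rest K j) j"

lemma psd_cholesky_rest: "psd_kernel K \<Longrightarrow> psd_kernel (cholesky_rest K j)"
  by (induction j) (auto intro: psd_kernel_schur_complement)

lemma cholesky_rest_zero:
  assumes "psd_kernel K" "n < j \<or> m < j"
  shows "cholesky_rest K j n m = 0"
  using assms(2)
proof (induction j arbitrary: n m)
  case (Suc j)
  note z = schur_complement_zero[OF psd_cholesky_rest[OF assms(1), of j], of j]
  show ?case
  proof (cases "n = j \<or> m = j")
    case True
    then show ?thesis using z by auto
  next
    case False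
    then have "n < j \<or> m < j" using Suc.prems by auto
    then show ?thesis using Suc.IH by (auto simp: schur_complement_def)
  qed
qed simp

lemma cholesky_sum:
  "K n m = (\<Sum>k<j. cholesky_rest K k n k * cholesky_rest K k k m / cholesky_rest K k k k) + cholesky_rest K j n m"
  by (induction j) (auto simp: schur_complement_def)

text \<open>Elimination of \<open>0, 1, 2, \<dots>\<close> in turn: the columns that are split off are the columns
  of the factor, and nothing is left at \<open>(n, m)\<close> once \<open>n\<close> or \<open>m\<close> has been eliminated.  Any
  sufficiently large \<open>j\<close> gives the same sum; the form with a free bound lets two rows be expanded
  over a common range.\<close>

lemma cholesky:
  assumes K: "psd_kernel (K :: nat \<Rightarrow> nat \<Rightarrow> complex)"
  obtains a where "\<And>n m j. n < j \<Longrightarrow> m < j \<Longrightarrow> K n m = (\<Sum>k<j. a n k * cnj (a m k))"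
proof
  let ?R = "cholesky_rest K"
  fix n m j :: nat assume "n < j"
  then have "K n m = (\<Sum>k<j. ?R k n k * ?R k k m / ?R k k k)"
    using cholesky_sum[of K n m j] cholesky_rest_zero[OF K] by simp
  moreover have "?R k n k * ?R k k m / ?R k k k
     = ?R k n k / of_real (sqrt (Re (?R k k k))) * cnj (?R k m k / of_real (sqrt (Re (?R k k k))))" for k
  proof -
    note P = psd_cholesky_rest[OF K, of k]
    have "?R k k k = of_real (sqrt (Re (?R k k k))) * of_real (sqrt (Re (?R k k k)))"
      using psd_kernel_diag[OF P, of k] by (simp flip: of_real_mult)
    then show ?thesis by (simp add: psd_kernel_herm[OF P])
  qed
  ultimately show "K n m = (\<Sum>k<j. ?R k n k / of_real (sqrt (Re (?R k k k))) * cnj (?R k m k / of_real (sqrt (Re (?R k k k)))))" by simp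
qed


section \<open>Fourier integrals and integrability on the circle\<close>

text \<open>The closed interval replaces the half-open one so that the fundamental theorem of
  calculus applies.\<close>

lemma integral_circle_haar:
  fixes f :: "real \<Rightarrow> complex"
  assumes [measurable]: "f \<in> borel_measurable borel"
  shows "(\<integral>\<theta>. f \<theta> \<partial>circle_haar) = (\<integral>\<theta>. indicator {0..2 * pi} \<theta> *\<^sub>R f \<theta> \<partial>lborel) / (2 * pi)"
proof -
  have "circle_haar = density (restrict_space lborel {0..<2 * pi}) (\<lambda>_. ennreal (1 / (2 * pi)))"
    by (rule measure_eqI) (auto simp: circle_haar_def emeasure_density nn_integral_cmult_indicator)
  then have "(\<integral>\<theta>. f \<theta> \<partial>circle_haar) = (\<integral>\<theta>. (1 / (2 * pi)) *\<^sub>R f \<theta> \<partial>restrict_space lborel {0..<2 * pi})"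
    by (subst (asm) eq_commute) (simp add: integral_density[symmetric] measurable_restrict_space1 del: integral_scaleR_right)
  also have "\<dots> = (\<integral>\<theta>. indicator {0..<2 * pi} \<theta> *\<^sub>R ((1 / (2 * pi)) *\<^sub>R f \<theta>) \<partial>lborel)"
    by (subst integral_restrict_space) (auto simp: measurable_restrict_space1)
  also have "\<dots> = (\<integral>\<theta>. (1 / (2 * pi)) *\<^sub>R (indicator {0..2 * pi} \<theta> *\<^sub>R f \<theta>) \<partial>lborel)"
  proof (rule integral_cong_AE)
    have "AE x in lborel. x \<noteq> 2 * pi" by (rule AE_lborel_singleton)
    then show "AE x in lborel. indicat_real {0..<2 * pi} x *\<^sub>R ((1 / (2 * pi)) *\<^sub>R f x)
        = (1 / (2 * pi)) *\<^sub>R (indicat_real {0..2 * pi} x *\<^sub>R f x)"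
      by eventually_elim (auto split: split_indicator)
  qed auto
  finally show ?thesis by (simp add: scaleR_conv_of_real)
qed

lemma integral_circle_haar_cis_power:
  assumes "0 < k"
  shows "(\<integral>\<theta>. cis \<theta> ^ k \<partial>circle_haar) = 0"
proof -
  have "(\<integral>\<theta>. indicator {0..2 * pi} \<theta> *\<^sub>R cis \<theta> ^ k \<partial>lborel)
      = cis (real k * (2 * pi)) / (\<i> * of_nat k) - cis (real k * 0) / (\<i> * of_nat k)"
  proof (rule integral_FTC_atLeastAtMost)
    fix x :: real
    have "((\<lambda>z. exp (\<i> * (of_nat k * z)) / (\<i> * of_nat k)) has_field_derivative
        exp (\<i> * (of_nat k * of_real x))) (at (of_real x))"
      using assms by (auto intro!: derivative_eq_intros simp: algebra_simps)
    from has_vector_derivative_real_field[OF this]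
    show "((\<lambda>x. cis (real k * x) / (\<i> * of_nat k)) has_vector_derivative cis x ^ k)
        (at x within {0..2 * pi})"
      unfolding Complex.DeMoivre unfolding cis_conv_exp by simp
  qed (auto intro!: continuous_intros)
  also have "\<dots> = 0"
    using assms cis_multiple_2pi[of "real k"] by (simp add: mult.commute)
  finally show ?thesis
    by (subst integral_circle_haar) (auto intro!: borel_measurable_continuous_onI continuous_intros)
qed

text \<open>On the circle a product of a power and a conjugate power depends on the difference of
  the exponents only; natural exponents force the case distinction.\<close>

lemma cis_power_cnj:
  "cis \<theta> ^ k * cnj (cis \<theta> ^ l) = (if l \<le> k then cis \<theta> ^ (k - l) else cnj (cis \<theta> ^ (l - k)))"
proof -
  have "cis \<theta> ^ k * cnj (cis \<theta> ^ l) = cis (real k * \<theta> - real l * \<theta>)"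
    unfolding Complex.DeMoivre cis_cnj cis_mult by simp
  moreover have "cis \<theta> ^ (k - l) = cis (real k * \<theta> - real l * \<theta>)" if "l \<le> k"
    using that unfolding Complex.DeMoivre by (simp add: of_nat_diff algebra_simps)
  moreover have "cnj (cis \<theta> ^ (l - k)) = cis (real k * \<theta> - real l * \<theta>)" if "\<not> l \<le> k"
    using that unfolding Complex.DeMoivre cis_cnj by (simp add: of_nat_diff algebra_simps)
  ultimately show ?thesis by (simp del: complex_cnj_power)
qed

lemma measurable_circle:
  assumes "sets M = sets circle_borel" "f \<in> borel_measurable borel"
  shows "f \<in> borel_measurable M"
  using assms(2) unfolding measurable_cong_sets[OF assms(1) refl] circle_borel_def
  by (rule measurable_restrict_space1)

lemma integral_circle_haar_orthonormal:
  "(\<integral>\<theta>. cis \<theta> ^ k * cnj (cis \<theta> ^ l) \<partial>circle_haar) = (if k = l then 1 else 0)"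
proof -
  interpret prob_space circle_haar by (rule prob_space_circle_haar)
  consider "k = l" | "l < k" | "k < l" by linarith
  then show ?thesis
  proof cases
    case 1
    then show ?thesis by (simp add: cis_power_cnj prob_space del: complex_cnj_power)
  next
    case 2
    then show ?thesis
      by (simp add: cis_power_cnj integral_circle_haar_cis_power del: complex_cnj_power)
  next
    case 3
    then show ?thesis
      by (simp add: cis_power_cnj integral_circle_haar_cis_power del: complex_cnj_power)
  qed
qed

lemma circle_measure_measurable:
  assumes "circle_measure \<nu>" "f \<in> borel_measurable borel"
  shows "f \<in> borel_measurable \<nu>"
  using assms by - (rule measurable_circle, simp_all add: circle_measure_def)

lemma circle_measure_integrable_bounded:
  fixes f :: "real \<Rightarrow> 'b :: {second_countable_topology, banach}"
  assumes \<nu>: "circle_measure \<nu>" and "f \<in> borel_measurable circle_borel"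
    and "\<And>x. x \<in> {0..<2 * pi} \<Longrightarrow> norm (f x) \<le> B"
  shows "integrable \<nu> f"
proof -
  interpret finite_measure \<nu> using \<nu> by (simp add: circle_measure_def)
  have "f \<in> borel_measurable \<nu>"
    using assms(2) \<nu> by (simp add: circle_measure_def cong: measurable_cong_sets)
  then show ?thesis
    using assms(3) circle_measure_space[OF \<nu>] by (intro integrable_const_bound[where B = B]) auto
qed

lemma circle_measure_integrable_continuous:
  fixes f :: "complex \<Rightarrow> 'b :: {second_countable_topology, banach}"
  assumes \<nu>: "circle_measure \<nu>" and f: "continuous_on UNIV f"
  shows "integrable \<nu> (\<lambda>\<theta>. f (cis \<theta>))"
proof -
  have "compact (f ` sphere 0 1)"
    using f by (intro compact_continuous_image) (auto intro: continuous_on_subset)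
  then obtain B where "\<forall>z\<in>sphere 0 1. norm (f z) \<le> B"
    by (auto dest!: compact_imp_bounded simp: bounded_iff)
  then have B: "norm (f z) \<le> B" if "cmod z = 1" for z using that by simp
  have "(\<lambda>\<theta>. f (cis \<theta>)) \<in> borel_measurable borel"
    by (intro borel_measurable_continuous_onI continuous_on_compose2[OF f] continuous_intros) auto
  then have "(\<lambda>\<theta>. f (cis \<theta>)) \<in> borel_measurable circle_borel"
    by (rule measurable_circle[OF refl])
  then show ?thesis
    by (rule circle_measure_integrable_bounded[OF \<nu>, where B = B]) (auto intro: B)
qed


section \<open>Covariances are exactly the positive semidefinite kernels\<close>

text \<open>The rows of a Cholesky factor, taken as coefficients of an orthonormal
  sequence, have the prescribed inner products.  The sequence starts with \<open>z\<close> and not with \<open>1\<close>, so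
  that all its members have mean zero.\<close>

lemma psd_kernel_covariance:
  assumes K: "psd_kernel (K :: nat \<Rightarrow> nat \<Rightarrow> complex)"
  obtains X :: "nat \<Rightarrow> real \<Rightarrow> complex"
    where "mean_zero_L2_process circle_haar UNIV X" "\<And>n m. cov circle_haar (X n) (X m) = K n m"
proof -
  interpret prob_space circle_haar by (rule prob_space_circle_haar)
  obtain a where a: "\<And>n m j. n < j \<Longrightarrow> m < j \<Longrightarrow> K n m = (\<Sum>k<j. a n k * cnj (a m k))"
    using cholesky[OF K] by metis
  define X where "X n \<theta> = (\<Sum>k\<le>n. a n k * cis \<theta> ^ Suc k)" for n \<theta>
  have meas [measurable]: "(\<lambda>\<theta>. cis \<theta> ^ k) \<in> borel_measurable circle_haar" for k
    by (rule measurable_circle) (auto intro!: borel_measurable_continuous_onI continuous_intros)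
  have X_meas [measurable]: "X n \<in> borel_measurable circle_haar" for n
    unfolding X_def by measurable
  have bnd: "cmod (X n \<theta>) \<le> (\<Sum>k\<le>n. cmod (a n k))" for n \<theta>
    unfolding X_def by (rule sum_norm_le) (simp add: norm_mult norm_power)
  have int: "integrable circle_haar (\<lambda>\<theta>. cis \<theta> ^ k * cnj (cis \<theta> ^ l))" for k l
  proof (rule integrable_const_bound[where B = 1])
    show "(\<lambda>\<theta>. cis \<theta> ^ k * cnj (cis \<theta> ^ l)) \<in> borel_measurable circle_haar"
      by (rule measurable_circle) (auto intro!: borel_measurable_continuous_onI continuous_intros)
  qed (simp add: norm_mult norm_power)
  have int1: "integrable circle_haar (\<lambda>\<theta>. cis \<theta> ^ k)" for k
    by (rule integrable_const_bound[where B = 1]) (auto simp: norm_mult norm_power)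
  \<comment> \<open>the factor is triangular, because the diagonal entries of the kernel are the same for all
    bounds of the sum\<close>
  have tri: "a n k = 0" if "n < k" for n k
  proof -
    have "(\<Sum>i<Suc n. a n i * cnj (a n i)) = (\<Sum>i<Suc k. a n i * cnj (a n i))"
      using a[of n "Suc n" n] a[of n "Suc k" n] that by simp
    then have "(\<Sum>i<Suc n. (cmod (a n i))\<^sup>2) = (\<Sum>i<Suc k. (cmod (a n i))\<^sup>2)"
      unfolding complex_norm_square[symmetric] of_real_sum[symmetric] of_real_eq_iff .
    also have "(\<Sum>i<Suc k. (cmod (a n i))\<^sup>2) = (\<Sum>i<Suc n. (cmod (a n i))\<^sup>2) + (\<Sum>i\<in>{Suc n..<Suc k}. (cmod (a n i))\<^sup>2)"
      using that sum.union_disjoint[of "{..<Suc n}" "{Suc n..<Suc k}" "\<lambda>i. (cmod (a n i))\<^sup>2"]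
      by (simp add: ivl_disj_un ivl_disj_int del: sum.lessThan_Suc)
    finally have "(\<Sum>i\<in>{Suc n..<Suc k}. (cmod (a n i))\<^sup>2) = 0" by simp
    then show "a n k = 0" using that by (subst (asm) sum_nonneg_eq_0_iff) auto
  qed
  show ?thesis
  proof
    show "mean_zero_L2_process circle_haar UNIV X"
      unfolding mean_zero_L2_process_def
    proof (intro conjI ballI)
      show "prob_space circle_haar" by (rule prob_space_circle_haar)
      fix n
      show "integrable circle_haar (\<lambda>\<omega>. (cmod (X n \<omega>))\<^sup>2)"
        by (rule integrable_const_bound[where B = "(\<Sum>k\<le>n. cmod (a n k))\<^sup>2"])
           (auto intro!: power_mono bnd)
      show "(\<integral>\<omega>. X n \<omega> \<partial>circle_haar) = 0"
        unfolding X_def using int1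
        by (subst Bochner_Integration.integral_sum)
           (auto simp: integral_circle_haar_cis_power simp del: power_Suc)
    qed simp
  next
    fix n m
    define j where "j = Suc (max n m)"
    have X: "X i \<theta> = (\<Sum>k<j. a i k * cis \<theta> ^ Suc k)" if "i < j" for i \<theta>
      unfolding X_def by (rule sum.mono_neutral_left) (use that tri in auto)
    have "cov circle_haar (X n) (X m)
       = (\<integral>\<theta>. (\<Sum>k<j. \<Sum>l<j. a n k * cnj (a m l) * (cis \<theta> ^ Suc k * cnj (cis \<theta> ^ Suc l))) \<partial>circle_haar)"
    proof -
      have nj: "n < j" "m < j" by (auto simp: j_def)
      have "X n \<theta> * cnj (X m \<theta>) = (\<Sum>k<j. \<Sum>l<j. a n k * cnj (a m l) * (cis \<theta> ^ Suc k * cnj (cis \<theta> ^ Suc l)))" for \<theta>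
        unfolding X[OF nj(1)] X[OF nj(2)] cnj_sum sum_product complex_cnj_mult
        by (intro sum.cong refl) (simp only: mult_ac)
      then show ?thesis unfolding cov_def by simp
    qed
    also have "\<dots> = (\<Sum>k<j. \<Sum>l<j. a n k * cnj (a m l) * (if Suc k = Suc l then 1 else 0))"
      unfolding integral_circle_haar_orthonormal[symmetric] using int
      by (simp add: Bochner_Integration.integral_sum del: power_Suc complex_cnj_power)
    also have "\<dots> = (\<Sum>k<j. a n k * cnj (a m k))"
      by (simp add: if_distrib[of "\<lambda>x. _ * x"] sum.delta cong: if_cong)
    also have "\<dots> = K n m" by (rule a[symmetric]) (auto simp: j_def)
    finally show "cov circle_haar (X n) (X m) = K n m" .
  qed
qed

text \<open>An encoding in the natural numbers need not be surjective, so the kernel is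
  extended by zero outside its range.\<close>

lemma psd_kernel_covariance_countable:
  fixes K :: "'i :: countable \<Rightarrow> 'i \<Rightarrow> complex"
  assumes K: "psd_kernel K"
  obtains X :: "'i \<Rightarrow> real \<Rightarrow> complex"
    where "mean_zero_L2_process circle_haar UNIV X" "\<And>u v. cov circle_haar (X u) (X v) = K u v"
proof -
  define R where "R = range (to_nat :: 'i \<Rightarrow> nat)"
  define K' where "K' n m = (if n \<in> R \<and> m \<in> R then K (from_nat n) (from_nat m) else 0)" for n m
  have "psd_kernel K'"
    unfolding psd_kernel_def
  proof (intro conjI allI impI)
    show "K' m n = cnj (K' n m)" for n m by (simp add: K'_def psd_kernel_herm[OF K])
    fix S :: "nat set" and a :: "nat \<Rightarrow> complex" assume S: "finite S"
    define T where "T = to_nat -` S \<inter> (UNIV :: 'i set)"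
    have T: "finite T" unfolding T_def by (rule finite_vimage_IntI[OF S inj_to_nat])
    have img: "S \<inter> R = to_nat ` T" by (auto simp: R_def T_def)
    have "(\<Sum>n\<in>S. \<Sum>m\<in>S. a n * cnj (a m) * K' n m) = (\<Sum>n\<in>S \<inter> R. \<Sum>m\<in>S \<inter> R. a n * cnj (a m) * K' n m)"
      using S by (intro sum.mono_neutral_cong_right) (auto simp: K'_def intro!: sum.mono_neutral_right sum.neutral)
    also have "\<dots> = (\<Sum>u\<in>T. \<Sum>v\<in>T. a (to_nat u) * cnj (a (to_nat v)) * K u v)"
      unfolding img by (simp add: sum.reindex K'_def R_def)
    finally show "0 \<le> Re (\<Sum>n\<in>S. \<Sum>m\<in>S. a n * cnj (a m) * K' n m)"
      using psd_kernel_form[OF K T] by simp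
  qed
  then obtain X where X: "mean_zero_L2_process circle_haar UNIV X" "\<And>n m. cov circle_haar (X n) (X m) = K' n m"
    using psd_kernel_covariance by blast
  show ?thesis
  proof
    show "mean_zero_L2_process circle_haar UNIV (\<lambda>u. X (to_nat u))"
      using X(1) by (simp add: mean_zero_L2_process_def)
    show "cov circle_haar (X (to_nat u)) (X (to_nat v)) = K u v" for u v
      by (simp add: X(2) K'_def R_def)
  qed
qed

lemma cov_commute: "cov M Y X = cnj (cov M X Y)"
  unfolding cov_def using Bochner_Integration.integral_cnj[of M "\<lambda>\<omega>. X \<omega> * cnj (Y \<omega>)"] by (simp add: mult.commute)

text \<open>The form is the second moment of \<open>\<Sum>u\<in>S. a u * X u\<close>.\<close>

lemma cov_form_nonneg:
  assumes X: "mean_zero_L2_process M I X" and S: "finite S" "S \<subseteq> I"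
  shows "0 \<le> Re (\<Sum>u\<in>S. \<Sum>v\<in>S. a u * cnj (a v) * cov M (X u) (X v))"
proof -
  have meas: "X u \<in> borel_measurable M" and sq: "integrable M (\<lambda>\<omega>. (cmod (X u \<omega>))\<^sup>2)" if "u \<in> S" for u
    using X S that by (auto simp: mean_zero_L2_process_def)
  have int: "integrable M (\<lambda>\<omega>. X u \<omega> * cnj (X v \<omega>))" if "u \<in> S" "v \<in> S" for u v
  proof (rule Bochner_Integration.integrable_bound)
    show "integrable M (\<lambda>\<omega>. (cmod (X u \<omega>))\<^sup>2 + (cmod (X v \<omega>))\<^sup>2)" using sq that by simp
    show "(\<lambda>\<omega>. X u \<omega> * cnj (X v \<omega>)) \<in> borel_measurable M"
      using meas that by (intro borel_measurable_times borel_measurable_continuous_on[of cnj] continuous_intros)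
    have "x * y \<le> x\<^sup>2 + y\<^sup>2" if "0 \<le> x" "0 \<le> y" for x y :: real
      using sum_squares_bound[of x y] mult_nonneg_nonneg[OF that] by linarith
    then show "AE \<omega> in M. norm (X u \<omega> * cnj (X v \<omega>)) \<le> norm ((cmod (X u \<omega>))\<^sup>2 + (cmod (X v \<omega>))\<^sup>2)"
      by (intro AE_I2) (simp add: norm_mult)
  qed
  have "(\<Sum>u\<in>S. \<Sum>v\<in>S. a u * cnj (a v) * cov M (X u) (X v))
     = (\<integral>\<omega>. (\<Sum>u\<in>S. \<Sum>v\<in>S. a u * cnj (a v) * (X u \<omega> * cnj (X v \<omega>))) \<partial>M)"
    unfolding cov_def using int by (simp add: Bochner_Integration.integral_sum)
  also have "\<dots> = (\<integral>\<omega>. of_real ((cmod (\<Sum>u\<in>S. a u * X u \<omega>))\<^sup>2) \<partial>M)"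
    unfolding complex_norm_square cnj_sum sum_product complex_cnj_mult by (simp add: mult_ac)
  also have "\<dots> = of_real (\<integral>\<omega>. (cmod (\<Sum>u\<in>S. a u * X u \<omega>))\<^sup>2 \<partial>M)"
    by (rule integral_complex_of_real)
  finally show ?thesis by simp
qed


section \<open>Bounded Borel functions as limits of real parts of polynomials\<close>

text \<open>Regularity of each measure gives a compact set inside and an open set
  outside that are close to each other; the union of the finitely many compact sets and the
  intersection of the open sets serve all measures at once, and a Urysohn function between them
  is close to the indicator.\<close>

lemma indicator_approx_continuous:
  fixes Ms :: "'a::euclidean_space measure set"
  assumes fin: "finite Ms" and M: "\<And>M. M \<in> Ms \<Longrightarrow> sets M = sets borel" "\<And>M. M \<in> Ms \<Longrightarrow> finite_measure M"
    and A: "A \<in> sets borel" and e: "0 < e"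
  obtains g :: "'a \<Rightarrow> real" where "continuous_on UNIV g" "\<And>x. \<bar>g x\<bar> \<le> 1"
    "\<And>M. M \<in> Ms \<Longrightarrow> (\<integral>x. \<bar>indicator A x - g x\<bar> \<partial>M) < e"
proof -
  have "\<exists>K U. compact K \<and> open U \<and> K \<subseteq> A \<and> A \<subseteq> U \<and> measure M (U - K) < e" if "M \<in> Ms" for M
  proof -
    interpret finite_measure M using M that by blast
    note s = M(1)[OF that]
    have fin_top: "emeasure M (space M) \<noteq> \<infinity>" by simp
    have AM: "A \<in> sets M" using A s by simp
    have "emeasure M A < emeasure M A + ennreal (e / 2)"
      using e by (simp add: ennreal_add_left_cancel_less emeasure_eq_measure ennreal_plus[symmetric] ennreal_less_iff del: ennreal_plus)
    also have "emeasure M A = (INF U \<in> {U. A \<subseteq> U \<and> open U}. emeasure M U)"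
      by (rule outer_regular[OF s fin_top A])
    finally obtain U where U: "A \<subseteq> U" "open U" "emeasure M U < emeasure M A + ennreal (e / 2)"
      unfolding INF_less_iff by (auto simp flip: outer_regular[OF s fin_top A])
    have "\<exists>K. K \<subseteq> A \<and> compact K \<and> emeasure M A < emeasure M K + ennreal (e / 2)"
    proof (cases "measure M A < e / 2")
      case True
      then show ?thesis by (intro exI[of _ "{}"]) (simp add: emeasure_eq_measure ennreal_less_iff)
    next
      case False
      then have "ennreal (measure M A - e / 2) < emeasure M A"
        using e by (simp add: emeasure_eq_measure ennreal_less_iff)
      also have "emeasure M A = (SUP K \<in> {K. K \<subseteq> A \<and> compact K}. emeasure M K)"
        by (rule inner_regular[OF s fin_top A])
      finally obtain K where K: "K \<subseteq> A" "compact K" "ennreal (measure M A - e / 2) < emeasure M K"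
        unfolding less_SUP_iff by auto
      then have "measure M A < measure M K + e / 2"
        using False by (simp add: emeasure_eq_measure ennreal_less_iff)
      then show ?thesis using K e
        by (auto simp: emeasure_eq_measure ennreal_less_iff ennreal_plus[symmetric] simp del: ennreal_plus)
    qed
    then obtain K where K: "K \<subseteq> A" "compact K" "emeasure M A < emeasure M K + ennreal (e / 2)" by auto
    have "measure M (U - K) = measure M U - measure M K"
      using U K by (intro finite_measure_Diff) (auto simp: s compact_imp_closed)
    also have "\<dots> < e"
      using U(3) K(3) e
      by (auto simp: emeasure_eq_measure ennreal_less_iff ennreal_plus[symmetric] simp del: ennreal_plus)
    finally show ?thesis using U K by blast
  qed
  then obtain K U where KU: "\<And>M. M \<in> Ms \<Longrightarrow> compact (K M) \<and> open (U M) \<and> K M \<subseteq> A \<and> A \<subseteq> U M \<and> measure M (U M - K M) < e"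
    by metis
  define K' where "K' = (\<Union>M\<in>Ms. K M)"
  define U' where "U' = (\<Inter>M\<in>Ms. U M)"
  have "closed K'" unfolding K'_def using fin KU by (intro closed_UN) (auto simp: compact_imp_closed)
  moreover have "closed (- U')" unfolding U'_def using fin KU by (intro closed_Compl open_INT) auto
  moreover have "K' \<inter> - U' = {}" using KU unfolding K'_def U'_def by blast
  ultimately obtain g :: "'a \<Rightarrow> real" where g: "continuous_on UNIV g" "\<And>x. g x \<in> closed_segment 1 0"
    "\<And>x. x \<in> K' \<Longrightarrow> g x = 1" "\<And>x. x \<in> - U' \<Longrightarrow> g x = 0"
    using Urysohn[of K' "- U'" "1::real" 0] by metis
  have g01: "0 \<le> g x" "g x \<le> 1" for x using g(2)[of x] by (auto simp: closed_segment_eq_real_ivl)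
  show ?thesis
  proof
    show "continuous_on UNIV g" "\<And>x. \<bar>g x\<bar> \<le> 1" using g g01 by auto
    fix M assume MM: "M \<in> Ms"
    interpret finite_measure M using M MM by blast
    note s = M(1)[OF MM]
    have [measurable]: "g \<in> borel_measurable M" "A \<in> sets M" "U M - K M \<in> sets M"
      using KU[OF MM] A g(1)
      by (auto simp: s compact_imp_closed measurable_cong_sets[OF s refl] intro!: borel_measurable_continuous_onI)
    have "(\<integral>x. \<bar>indicator A x - g x\<bar> \<partial>M) \<le> (\<integral>x. indicator (U M - K M) x \<partial>M)"
    proof (rule integral_mono)
      fix x
      have "\<bar>indicator A x - g x\<bar> \<le> 1" using g01[of x] by (auto split: split_indicator)
      moreover have "indicator A x - g x = 0" if "x \<notin> U M - K M"
      proof (cases "x \<in> K M")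
        case True
        then have "x \<in> A" "x \<in> K'" using KU[OF MM] MM by (auto simp: K'_def)
        then show ?thesis using g(3) by simp
      next
        case False
        then have "x \<notin> U M" using that by auto
        then have "x \<notin> A" "x \<in> - U'" using KU[OF MM] MM by (auto simp: U'_def)
        then show ?thesis using g(4) by simp
      qed
      ultimately show "\<bar>indicator A x - g x\<bar> \<le> indicator (U M - K M) x"
        by (auto split: split_indicator)
    next
      show "integrable M (\<lambda>x. \<bar>indicator A x - g x\<bar>)"
        using g01 by (intro integrable_const_bound[where B = 1]) (auto split: split_indicator)
    qed (auto intro!: integrable_real_indicator simp: emeasure_eq_measure)
    also have "\<dots> < e" using KU[OF MM] sets.sets_into_space[of "U M - K M" M]
      by (simp add: Int_absorb1 Int_absorb2)
    finally show "(\<integral>x. \<bar>indicator A x - g x\<bar> \<partial>M) < e" .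
  qed
qed

text \<open>One approximant has to serve Haar measure and the given measure
  simultaneously, hence the finite set of measures.  Density is shown for nonnegative functions by
  passing from indicators to monotone limits; truncation at the bound of \<open>f\<close> then makes the
  approximant obey the same bound.\<close>

lemma bounded_borel_approx_continuous:
  fixes Ms :: "'a::euclidean_space measure set" and f :: "'a \<Rightarrow> real"
  assumes fin: "finite Ms" and M: "\<And>M. M \<in> Ms \<Longrightarrow> sets M = sets borel" "\<And>M. M \<in> Ms \<Longrightarrow> finite_measure M"
    and f: "f \<in> borel_measurable borel" and B: "\<And>x. \<bar>f x\<bar> \<le> B" and e: "0 < e"
  obtains g where "continuous_on UNIV g" "\<And>x. \<bar>g x\<bar> \<le> B"
    "\<And>M. M \<in> Ms \<Longrightarrow> (\<integral>x. \<bar>f x - g x\<bar> \<partial>M) < e"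
proof -
  define approx where "approx f \<longleftrightarrow> (\<forall>e>0. \<exists>g. continuous_on UNIV g \<and> bounded (range g) \<and>
     (\<forall>M\<in>Ms. (\<integral>x. \<bar>f x - g x\<bar> \<partial>M) < e))" for f :: "'a \<Rightarrow> real"
  have int: "integrable M h" if "M \<in> Ms" "h \<in> borel_measurable borel" and bh: "bounded (range h)" for M and h :: "'a \<Rightarrow> real"
  proof -
    interpret finite_measure M using M that by blast
    have [measurable]: "h \<in> borel_measurable M"
      using that(2) by (simp add: measurable_cong_sets[OF M(1)[OF that(1)] refl])
    obtain B where "\<And>x. \<bar>h x\<bar> \<le> B" using bh by (auto simp: bounded_iff)
    then show ?thesis by (intro integrable_const_bound[where B = B]) auto
  qed
  have approx_add: "approx (\<lambda>x. u x + v x)"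
    if u: "approx u" "u \<in> borel_measurable borel" "bounded (range u)"
      and v: "approx v" "v \<in> borel_measurable borel" "bounded (range v)" for u v
    unfolding approx_def
  proof (intro allI impI)
    fix e :: real assume "0 < e"
    then have "0 < e / 2" by simp
    obtain g where g: "continuous_on UNIV g" "bounded (range g)" "\<And>M. M \<in> Ms \<Longrightarrow> (\<integral>x. \<bar>u x - g x\<bar> \<partial>M) < e / 2"
      using u(1) \<open>0 < e / 2\<close> unfolding approx_def by meson
    obtain h where h: "continuous_on UNIV h" "bounded (range h)" "\<And>M. M \<in> Ms \<Longrightarrow> (\<integral>x. \<bar>v x - h x\<bar> \<partial>M) < e / 2"
      using v(1) \<open>0 < e / 2\<close> unfolding approx_def by meson
    have "(\<integral>x. \<bar>u x + v x - (g x + h x)\<bar> \<partial>M) < e" if "M \<in> Ms" for M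
    proof -
      have i: "integrable M u" "integrable M v" "integrable M g" "integrable M h"
        using that u v g h by (auto intro!: int borel_measurable_continuous_onI)
      have "(\<integral>x. \<bar>u x + v x - (g x + h x)\<bar> \<partial>M) \<le> (\<integral>x. \<bar>u x - g x\<bar> + \<bar>v x - h x\<bar> \<partial>M)"
        using i by (intro integral_mono) auto
      also have "\<dots> = (\<integral>x. \<bar>u x - g x\<bar> \<partial>M) + (\<integral>x. \<bar>v x - h x\<bar> \<partial>M)"
        using i by (intro Bochner_Integration.integral_add) auto
      also have "\<dots> < e" using g(3)[OF that] h(3)[OF that] by simp
      finally show ?thesis .
    qed
    moreover have "bounded (range (\<lambda>x. g x + h x))"
      using bounded_plus_comp[OF g(2) h(2)] by simp
    ultimately show "\<exists>k. continuous_on UNIV k \<and> bounded (range k) \<and> (\<forall>M\<in>Ms. (\<integral>x. \<bar>u x + v x - k x\<bar> \<partial>M) < e)"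
      using g h by (intro exI[of _ "\<lambda>x. g x + h x"]) (auto intro: continuous_intros)
  qed
  have approx_cmult: "approx (\<lambda>x. c * u x)" if u: "approx u" for u c
    unfolding approx_def
  proof (intro allI impI)
    fix e :: real assume "0 < e"
    then have "0 < e / (\<bar>c\<bar> + 1)" by simp
    then obtain g where g: "continuous_on UNIV g" "bounded (range g)" "\<And>M. M \<in> Ms \<Longrightarrow> (\<integral>x. \<bar>u x - g x\<bar> \<partial>M) < e / (\<bar>c\<bar> + 1)"
      using u unfolding approx_def by meson
    have "(\<integral>x. \<bar>c * u x - c * g x\<bar> \<partial>M) < e" if "M \<in> Ms" for M
    proof -
      have "(\<integral>x. \<bar>c * u x - c * g x\<bar> \<partial>M) = \<bar>c\<bar> * (\<integral>x. \<bar>u x - g x\<bar> \<partial>M)"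
        by (simp add: abs_mult flip: right_diff_distrib)
      also have "\<dots> \<le> (\<bar>c\<bar> + 1) * (\<integral>x. \<bar>u x - g x\<bar> \<partial>M)"
        by (intro mult_right_mono) auto
      also have "\<dots> < e" using g(3)[OF that] by (simp add: field_simps)
      finally show ?thesis .
    qed
    moreover have "bounded (range (\<lambda>x. c * g x))"
      using bounded_scaleR_comp[OF g(2), of c] by simp
    ultimately show "\<exists>k. continuous_on UNIV k \<and> bounded (range k) \<and> (\<forall>M\<in>Ms. (\<integral>x. \<bar>c * u x - k x\<bar> \<partial>M) < e)"
      using g by (intro exI[of _ "\<lambda>x. c * g x"]) (auto intro: continuous_intros)
  qed
  have nonneg: "bounded (range u) \<longrightarrow> approx u"
    if "u \<in> borel_measurable borel" "\<And>x. 0 \<le> u x" for u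
    using that
  proof (induction u rule: borel_measurable_induct_real)
    case (set A)
    show ?case
      unfolding approx_def
    proof (intro impI allI)
      fix e :: real assume "0 < e"
      obtain g :: "'a \<Rightarrow> real" where g: "continuous_on UNIV g" "\<And>x. \<bar>g x\<bar> \<le> 1"
        "\<And>M. M \<in> Ms \<Longrightarrow> (\<integral>x. \<bar>indicator A x - g x\<bar> \<partial>M) < e"
        using indicator_approx_continuous[OF fin M set \<open>0 < e\<close>] by blast
      then have "bounded (range g)" by (auto simp: bounded_iff)
      with g show "\<exists>g. continuous_on UNIV g \<and> bounded (range g) \<and> (\<forall>M\<in>Ms. (\<integral>x. \<bar>indicator A x - g x\<bar> \<partial>M) < e)"
        by blast
    qed
  next
    case (mult u c)
    show ?case
    proof (cases "c = 0")
      case True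
      then show ?thesis unfolding approx_def by (auto intro!: exI[of _ "\<lambda>_. 0"])
    next
      case False
      show ?thesis
      proof
        assume "bounded (range (\<lambda>x. c * u x))"
        from bounded_scaleR_comp[OF this, of "inverse c"] have "bounded (range u)"
          using False by (simp add: field_simps)
        then show "approx (\<lambda>x. c * u x)" using approx_cmult mult by blast
      qed
    qed
  next
    case (add u v)
    show ?case
    proof
      assume "bounded (range (\<lambda>x. v x + u x))"
      then obtain B where "\<And>x. \<bar>v x + u x\<bar> \<le> B" by (auto simp: bounded_iff)
      then have "\<bar>u x\<bar> \<le> B \<and> \<bar>v x\<bar> \<le> B" for x
        using add.hyps(2,4)[of x] by (smt (verit))
      then have "bounded (range u)" "bounded (range v)" by (auto simp: bounded_iff)
      then show "approx (\<lambda>x. v x + u x)" using add by (intro approx_add) auto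
    qed
  next
    case (seq U)
    show ?case
    proof
      assume "bounded (range u)"
      then obtain B where B: "\<And>x. \<bar>u x\<bar> \<le> B" by (auto simp: bounded_iff)
      have Uu: "U i x \<le> u x" for i x
        using seq.hyps(4)[of x] seq.hyps(3) by (intro incseq_le) (auto simp: incseq_def le_fun_def)
      then have UB: "\<bar>U i x\<bar> \<le> B" for i x using seq.hyps(2)[of i x] B[of x] by (smt (verit))
      then have bU: "bounded (range (U i))" for i by (auto simp: bounded_iff)
      have lim: "(\<lambda>i. \<integral>x. \<bar>u x - U i x\<bar> \<partial>M) \<longlonglongrightarrow> 0" if "M \<in> Ms" for M
      proof -
        interpret finite_measure M using M that by blast
        have [measurable]: "u \<in> borel_measurable M" "U i \<in> borel_measurable M" for i
          using that seq.hyps(1) \<open>u \<in> borel_measurable borel\<close> by (simp_all add: measurable_cong_sets[OF M(1)[OF that] refl])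
        have "(\<lambda>i. \<integral>x. \<bar>u x - U i x\<bar> \<partial>M) \<longlonglongrightarrow> (\<integral>x. 0 \<partial>M)"
        proof (rule integral_dominated_convergence[where w = "\<lambda>_. 2 * B"])
          show "AE x in M. (\<lambda>i. \<bar>u x - U i x\<bar>) \<longlonglongrightarrow> 0"
            using seq.hyps(4) by (intro AE_I2) (auto intro!: tendsto_eq_intros)
          show "AE x in M. norm \<bar>u x - U i x\<bar> \<le> 2 * B" for i
            using B UB[of i] by (intro AE_I2) (smt (verit) real_norm_def)
        qed auto
        then show ?thesis by simp
      qed
      show "approx u"
        unfolding approx_def
      proof (intro allI impI)
        fix e :: real assume "0 < e"
        then have "0 < e / 2" by simp
        have "\<forall>\<^sub>F i in sequentially. \<forall>M\<in>Ms. (\<integral>x. \<bar>u x - U i x\<bar> \<partial>M) < e / 2"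
          using fin order_tendstoD(2)[OF lim \<open>0 < e / 2\<close>] by (intro eventually_ball_finite) auto
        then obtain i where i: "\<And>M. M \<in> Ms \<Longrightarrow> (\<integral>x. \<bar>u x - U i x\<bar> \<partial>M) < e / 2"
          by (auto simp: eventually_sequentially)
        obtain g where g: "continuous_on UNIV g" "bounded (range g)" "\<And>M. M \<in> Ms \<Longrightarrow> (\<integral>x. \<bar>U i x - g x\<bar> \<partial>M) < e / 2"
          using seq.IH[of i] bU[of i] \<open>0 < e / 2\<close> unfolding approx_def by meson
        have "(\<integral>x. \<bar>u x - g x\<bar> \<partial>M) < e" if "M \<in> Ms" for M
        proof -
          have ii: "integrable M u" "integrable M (U i)" "integrable M g"
            using that g bU \<open>bounded (range u)\<close> \<open>u \<in> borel_measurable borel\<close>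
            by (auto intro!: int seq.hyps(1) intro: borel_measurable_continuous_onI)
          have "(\<integral>x. \<bar>u x - g x\<bar> \<partial>M) \<le> (\<integral>x. \<bar>u x - U i x\<bar> + \<bar>U i x - g x\<bar> \<partial>M)"
            using ii by (intro integral_mono) auto
          also have "\<dots> = (\<integral>x. \<bar>u x - U i x\<bar> \<partial>M) + (\<integral>x. \<bar>U i x - g x\<bar> \<partial>M)"
            using ii by (intro Bochner_Integration.integral_add) auto
          also have "\<dots> < e" using g(3)[OF that] i[OF that] by simp
          finally show ?thesis .
        qed
        then show "\<exists>g. continuous_on UNIV g \<and> bounded (range g) \<and> (\<forall>M\<in>Ms. (\<integral>x. \<bar>u x - g x\<bar> \<partial>M) < e)"
          using g by blast
      qed
    qed
  qed
  \<comment> \<open>shifting by \<open>B\<close> makes \<open>f\<close> nonnegative\<close>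
  have "approx (\<lambda>x. f x + B)"
  proof (rule nonneg[rule_format])
    show "0 \<le> f x + B" for x using B[of x] by linarith
    show "bounded (range (\<lambda>x. f x + B))"
    proof (rule boundedI)
      fix y assume "y \<in> range (\<lambda>x. f x + B)"
      then obtain x where "y = f x + B" by blast
      then show "norm y \<le> 2 * B" using B[of x] by simp
    qed
  qed (use f in measurable)
  then obtain g where g: "continuous_on UNIV g" "bounded (range g)"
     "\<And>M. M \<in> Ms \<Longrightarrow> (\<integral>x. \<bar>f x + B - g x\<bar> \<partial>M) < e"
    unfolding approx_def using e by meson
  define k where "k x = max (- B) (min B (g x - B))" for x
  have B0: "0 \<le> B" using B[of undefined] by linarith
  show ?thesis
  proof
    show k: "continuous_on UNIV k" unfolding k_def using g by (intro continuous_intros)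
    show kB: "\<bar>k x\<bar> \<le> B" for x unfolding k_def using B0 by auto
    fix MM assume MM: "MM \<in> Ms"
    have "bounded (range f)" "bounded (range k)" using B kB by (auto simp: bounded_iff)
    then have "integrable MM f" "integrable MM k" "integrable MM g"
      using MM f g k by (auto intro!: int intro: borel_measurable_continuous_onI)
    moreover have "integrable MM (\<lambda>_. B)"
      using M(2)[OF MM] by (rule finite_measure.integrable_const)
    ultimately have "(\<integral>x. \<bar>f x - k x\<bar> \<partial>MM) \<le> (\<integral>x. \<bar>f x + B - g x\<bar> \<partial>MM)"
    proof (intro integral_mono)
      show "\<bar>f x - k x\<bar> \<le> \<bar>f x + B - g x\<bar>" for x
        using B[of x] unfolding k_def by linarith
    qed auto
    also have "\<dots> < e" using g(3)[OF MM] .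
    finally show "(\<integral>x. \<bar>f x - k x\<bar> \<partial>MM) < e" .
  qed
qed

text \<open>The function is continuous off its branch cut, and the branch cut is a closed set on
  which it vanishes.\<close>

lemma Arg2pi_measurable [measurable]: "Arg2pi \<in> borel_measurable borel"
proof -
  have cl: "closed (\<real>\<^sub>\<ge>\<^sub>0 :: complex set)" by (rule closed_nonneg_Reals_complex)
  have "(\<lambda>z. if z \<in> \<real>\<^sub>\<ge>\<^sub>0 then 0 else Arg2pi z) \<in> borel_measurable borel"
  proof (rule borel_measurable_continuous_on_if)
    show "\<real>\<^sub>\<ge>\<^sub>0 \<in> sets (borel :: complex measure)" using cl by auto
    show "continuous_on (- \<real>\<^sub>\<ge>\<^sub>0) Arg2pi"
      by (intro continuous_at_imp_continuous_on) (auto intro: continuous_at_Arg2pi)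
  qed auto
  also have "(\<lambda>z. if z \<in> \<real>\<^sub>\<ge>\<^sub>0 then 0 else Arg2pi z) = Arg2pi"
    by (auto simp: Arg2pi_eq_0 fun_eq_iff complex_nonneg_Reals_iff complex_is_Real_iff)
  finally show ?thesis .
qed

lemma Arg2pi_cis: "0 \<le> \<theta> \<Longrightarrow> \<theta> < 2 * pi \<Longrightarrow> Arg2pi (cis \<theta>) = \<theta>"
  by (rule Arg2pi_unique[of 1]) (simp_all add: cis_conv_exp)

text \<open>The real trigonometric polynomials, described as boundary values: on the unit
  circle, negative powers of \<open>z\<close> can be replaced by conjugates, whose real parts are those of
  positive powers.\<close>

definition Re_poly_on_circle :: "(complex \<Rightarrow> real) \<Rightarrow> bool" where
  "Re_poly_on_circle f \<longleftrightarrow> (\<exists>G. \<forall>z. cmod z = 1 \<longrightarrow> f z = Re (poly G z))"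

lemma Re_poly_on_circle_add:
  assumes "Re_poly_on_circle f" "Re_poly_on_circle g"
  shows "Re_poly_on_circle (\<lambda>z. f z + g z)"
proof -
  from assms obtain F G where "\<And>z. cmod z = 1 \<Longrightarrow> f z = Re (poly F z)" "\<And>z. cmod z = 1 \<Longrightarrow> g z = Re (poly G z)"
    unfolding Re_poly_on_circle_def by metis
  then show ?thesis unfolding Re_poly_on_circle_def by (intro exI[of _ "F + G"]) auto
qed

lemma Re_poly_on_circle_sum:
  assumes "\<And>i. i \<in> A \<Longrightarrow> Re_poly_on_circle (f i)"
  shows "Re_poly_on_circle (\<lambda>z. \<Sum>i\<in>A. f i z)"
proof -
  have "Re_poly_on_circle (\<lambda>_. 0)"
    unfolding Re_poly_on_circle_def by (rule exI[of _ 0]) simp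
  with assms show ?thesis
    by (induction A rule: infinite_finite_induct) (simp_all add: Re_poly_on_circle_add)
qed

text \<open>On the circle \<open>cnj z\<close> is inverse to \<open>z\<close>, so one of the two powers cancels
  completely; a surviving power of \<open>cnj z\<close> is turned into one of \<open>z\<close> by conjugating.\<close>

lemma Re_poly_on_circle_monom:
  "Re_poly_on_circle (\<lambda>z. Re (c * (z ^ k * cnj z ^ l)))"
proof -
  have unit: "z ^ j * cnj z ^ j = 1" if "cmod z = 1" for z :: complex and j
    using that complex_norm_square[of z] by (simp flip: power_mult_distrib)
  show ?thesis
  proof (cases "l \<le> k")
    case True
    have "z ^ k * cnj z ^ l = z ^ (k - l)" if "cmod z = 1" for z
    proof -
      have "z ^ k = z ^ (k - l) * z ^ l" using True by (simp flip: power_add)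
      then have "z ^ k * cnj z ^ l = z ^ (k - l) * (z ^ l * cnj z ^ l)" by (simp only: mult.assoc)
      then show ?thesis using unit[OF that, of l] by simp
    qed
    then show ?thesis unfolding Re_poly_on_circle_def
      by (intro exI[of _ "monom c (k - l)"]) (auto simp: poly_monom)
  next
    case False
    have "z ^ k * cnj z ^ l = cnj z ^ (l - k)" if "cmod z = 1" for z
    proof -
      have "cnj z ^ l = cnj z ^ k * cnj z ^ (l - k)" using False by (simp flip: power_add)
      then have "z ^ k * cnj z ^ l = (z ^ k * cnj z ^ k) * cnj z ^ (l - k)" by (simp only: mult.assoc)
      then show ?thesis using unit[OF that, of k] by simp
    qed
    moreover have "Re (c * cnj z ^ j) = Re (cnj c * z ^ j)" for z j
      using cnj.sel(1)[of "c * cnj z ^ j"] by simp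
    ultimately show ?thesis unfolding Re_poly_on_circle_def
      by (intro exI[of _ "monom (cnj c) (l - k)"]) (auto simp: poly_monom)
  qed
qed

text \<open>From \<open>Re a * Re b = Re (a * b + a * cnj b) / 2\<close>, where \<open>a * cnj b\<close> is expanded into the
  monomials of the preceding lemma.\<close>

lemma Re_poly_on_circle_mult:
  assumes "Re_poly_on_circle f" "Re_poly_on_circle g"
  shows "Re_poly_on_circle (\<lambda>z. f z * g z)"
proof -
  from assms obtain F G where F: "\<And>z. cmod z = 1 \<Longrightarrow> f z = Re (poly F z)" and G: "\<And>z. cmod z = 1 \<Longrightarrow> g z = Re (poly G z)"
    unfolding Re_poly_on_circle_def by metis
  have *: "Re a * Re b = Re (a * b / 2) + Re (a * cnj b / 2)" for a b :: complex
    by (simp add: field_simps)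
  have "Re_poly_on_circle (\<lambda>z. Re (poly F z * poly G z / 2))"
    unfolding Re_poly_on_circle_def by (intro exI[of _ "smult (1/2) (F * G)"]) auto
  moreover have "Re_poly_on_circle (\<lambda>z. Re (poly F z * cnj (poly G z) / 2))"
  proof -
    have "(\<lambda>z. Re (poly F z * cnj (poly G z) / 2))
      = (\<lambda>z. \<Sum>i\<le>degree F. \<Sum>j\<le>degree G. Re ((coeff F i * cnj (coeff G j) / 2) * (z ^ i * cnj z ^ j)))"
      unfolding poly_altdef cnj_sum sum_product sum_divide_distrib Re_sum
      by (intro ext sum.cong refl) (simp add: mult_ac)
    then show ?thesis by (simp only: Re_poly_on_circle_sum Re_poly_on_circle_monom)
  qed
  ultimately have "Re_poly_on_circle (\<lambda>z. Re (poly F z * poly G z / 2) + Re (poly F z * cnj (poly G z) / 2))"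
    by (rule Re_poly_on_circle_add)
  then show ?thesis unfolding *[symmetric] Re_poly_on_circle_def using F G by auto
qed

lemma Re_poly_on_circle_real_polynomial:
  assumes "real_polynomial_function f"
  shows "Re_poly_on_circle f"
  using assms
proof (induction rule: real_polynomial_function.induct)
  case (linear f)
  interpret bounded_linear f by fact
  define a b where "a = f 1" and "b = f \<i>"
  have "f z = Re (poly [:0, Complex a (- b):] z)" for z
  proof -
    have "f z = f (Re z *\<^sub>R 1 + Im z *\<^sub>R \<i>)" by (rule arg_cong[of _ _ f]) (simp add: complex_eq_iff)
    also have "\<dots> = Re z * a + Im z * b" unfolding add scaleR a_def b_def by simp
    finally show ?thesis by (simp add: mult.commute)
  qed
  then show ?case unfolding Re_poly_on_circle_def by blast
next
  case (const c)
  then show ?case unfolding Re_poly_on_circle_def by (intro exI[of _ "[:of_real c:]"]) simp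
next
  case (add f g)
  show ?case by (rule Re_poly_on_circle_add) fact+
next
  case (mult f g)
  show ?case by (rule Re_poly_on_circle_mult) fact+
qed

text \<open>The interval is wrapped around the unit circle.  There continuous functions
  are dense, and the Stone-Weierstrass theorem replaces them by real polynomials in the two
  coordinates, which are real parts of polynomials in \<open>z\<close>.\<close>

lemma bounded_borel_approx_Re_poly:
  assumes \<nu>: "circle_measure \<nu>"
    and h: "h \<in> borel_measurable circle_borel" and B: "\<And>\<theta>. \<theta> \<in> {0..<2 * pi} \<Longrightarrow> \<bar>h \<theta>\<bar> \<le> B" and e: "0 < e"
  obtains G where "\<And>\<theta>. \<bar>Re (poly G (cis \<theta>))\<bar> \<le> B + 1"
    "(\<integral>\<theta>. \<bar>h \<theta> - Re (poly G (cis \<theta>))\<bar> \<partial>\<nu>) < e"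
    "(\<integral>\<theta>. \<bar>h \<theta> - Re (poly G (cis \<theta>))\<bar> \<partial>circle_haar) < e"
proof -
  define Cs where "Cs = {\<nu>, circle_haar}"
  define Ms where "Ms = (\<lambda>M. distr M (borel :: complex measure) cis) ` Cs"
  have Cs: "circle_measure M" if "M \<in> Cs" for M
    using that \<nu> circle_measure_haar by (auto simp: Cs_def)
  have cis_meas: "cis \<in> borel_measurable M" if "M \<in> Cs" for M
    by (rule circle_measure_measurable[OF Cs[OF that]])
       (auto intro!: borel_measurable_continuous_onI continuous_intros)
  have fin: "finite_measure M" if "M \<in> Cs" for M using Cs[OF that] by (simp add: circle_measure_def)
  define f where "f z = h (Arg2pi z)" for z
  have fB: "\<bar>f z\<bar> \<le> B" for z
    unfolding f_def using Arg2pi[of z] by (intro B) auto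
  have "Arg2pi \<in> measurable borel circle_borel"
    unfolding circle_borel_def
    by (rule measurable_restrict_space2) (use Arg2pi in auto)
  then have f: "f \<in> borel_measurable borel"
    unfolding f_def using h by (rule measurable_compose)
  define m where "m = Max ((\<lambda>M. measure M (space M)) ` Cs)"
  \<comment> \<open>a uniform error \<open>d\<close> costs at most \<open>e / 2\<close> in the integrals and \<open>1\<close> in the bound\<close>
  define d where "d = min 1 (e / (2 * (1 + m)))"
  have mle: "measure M (space M) \<le> m" if "M \<in> Cs" for M
    unfolding m_def using that by (intro Max_ge) (auto simp: Cs_def)
  have m0: "0 \<le> m"
    using order_trans[OF measure_nonneg mle[of \<nu>]] by (simp add: Cs_def)
  have d: "0 < d" "d \<le> 1" "d * (1 + m) \<le> e / 2"
  proof -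
    show "0 < d" "d \<le> 1" using m0 e by (auto simp: d_def)
    have "d * (1 + m) \<le> e / (2 * (1 + m)) * (1 + m)"
      using m0 by (intro mult_right_mono) (auto simp: d_def)
    also have "\<dots> = e / 2" using m0 by (simp add: field_simps)
    finally show "d * (1 + m) \<le> e / 2" .
  qed
  have Ms: "sets M = sets borel" "finite_measure M" if M: "M \<in> Ms" for M
  proof -
    obtain N where N: "N \<in> Cs" "M = distr N borel cis" using M by (auto simp: Ms_def)
    show "sets M = sets borel" by (simp add: N)
    show "finite_measure M" unfolding N(2)
      by (rule finite_measure.finite_measure_distr[OF fin[OF N(1)] cis_meas[OF N(1)]])
  qed
  have "finite Ms" "0 < e / 2" using e by (auto simp: Ms_def Cs_def)
  obtain g where g: "continuous_on UNIV g" "\<And>z. \<bar>g z\<bar> \<le> B"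
    "\<And>M. M \<in> Ms \<Longrightarrow> (\<integral>z. \<bar>f z - g z\<bar> \<partial>M) < e / 2"
    using bounded_borel_approx_continuous[OF \<open>finite Ms\<close> Ms f fB \<open>0 < e / 2\<close>] by blast
  have "continuous_on (sphere 0 1) g" using g(1) by (rule continuous_on_subset) simp
  from Stone_Weierstrass_real_polynomial_function[OF compact_sphere this d(1)]
  obtain p where p: "real_polynomial_function p" "\<And>z. z \<in> sphere 0 1 \<Longrightarrow> \<bar>g z - p z\<bar> < d"
    by blast
  obtain G where G: "\<And>z. cmod z = 1 \<Longrightarrow> p z = Re (poly G z)"
    using Re_poly_on_circle_real_polynomial[OF p(1)] by (auto simp: Re_poly_on_circle_def)
  have gG: "\<bar>g (cis \<theta>) - Re (poly G (cis \<theta>))\<bar> < d" for \<theta>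
    using p(2)[of "cis \<theta>"] G[of "cis \<theta>"] by simp
  have G_bound: "\<bar>Re (poly G (cis \<theta>))\<bar> \<le> B + 1" for \<theta>
    using gG[of \<theta>] g(2)[of "cis \<theta>"] d(2) by linarith
  have G_meas: "(\<lambda>\<theta>. Re (poly G (cis \<theta>))) \<in> borel_measurable borel"
    by (auto intro!: borel_measurable_continuous_onI continuous_intros)
  have g_meas: "(\<lambda>\<theta>. g (cis \<theta>)) \<in> borel_measurable borel"
    using g(1) by (auto intro!: borel_measurable_continuous_onI continuous_on_compose2[OF g(1)] continuous_intros)
  have "(\<integral>\<theta>. \<bar>h \<theta> - Re (poly G (cis \<theta>))\<bar> \<partial>M) < e" if M: "M \<in> Cs" for M
  proof -
    interpret finite_measure M by (rule fin[OF M])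
    have sp: "space M = {0..<2 * pi}" by (rule circle_measure_space[OF Cs[OF M]])
    have to_cb: "k \<in> borel_measurable borel \<Longrightarrow> k \<in> borel_measurable circle_borel" for k :: "real \<Rightarrow> real"
      by (rule measurable_circle) auto
    have int: "integrable M h" "integrable M (\<lambda>\<theta>. g (cis \<theta>))" "integrable M (\<lambda>\<theta>. Re (poly G (cis \<theta>)))"
      by (rule circle_measure_integrable_bounded[OF Cs[OF M] _ , where B = B]
            circle_measure_integrable_bounded[OF Cs[OF M] _ , where B = "B + 1"];
          use h B g(2) G_bound to_cb[OF g_meas] to_cb[OF G_meas] in simp)+
    have "(\<integral>\<theta>. \<bar>h \<theta> - Re (poly G (cis \<theta>))\<bar> \<partial>M) \<le> (\<integral>\<theta>. \<bar>h \<theta> - g (cis \<theta>)\<bar> + d \<partial>M)"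
    proof (rule integral_mono)
      show "\<bar>h \<theta> - Re (poly G (cis \<theta>))\<bar> \<le> \<bar>h \<theta> - g (cis \<theta>)\<bar> + d" for \<theta>
        using gG[of \<theta>] by linarith
    qed (use int in auto)
    also have "\<dots> = (\<integral>\<theta>. \<bar>h \<theta> - g (cis \<theta>)\<bar> \<partial>M) + d * measure M (space M)"
      using int by (subst Bochner_Integration.integral_add) auto
    also have "(\<integral>\<theta>. \<bar>h \<theta> - g (cis \<theta>)\<bar> \<partial>M) = (\<integral>\<theta>. \<bar>f (cis \<theta>) - g (cis \<theta>)\<bar> \<partial>M)"
      unfolding f_def by (intro Bochner_Integration.integral_cong) (auto simp: sp Arg2pi_cis)
    also have "\<dots> = (\<integral>z. \<bar>f z - g z\<bar> \<partial>distr M borel cis)"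
    proof (rule integral_distr[symmetric, OF cis_meas[OF M]])
      have "g \<in> borel_measurable borel" using g(1) by (rule borel_measurable_continuous_onI)
      then show "(\<lambda>z. \<bar>f z - g z\<bar>) \<in> borel_measurable borel" using f by simp
    qed
    also have "\<dots> < e / 2" using M by (intro g(3)) (auto simp: Ms_def)
    also have "d * measure M (space M) \<le> d * (1 + m)"
      using mle[OF M] d(1) by (intro mult_left_mono) auto
    also have "\<dots> \<le> e / 2" by (rule d)
    finally show ?thesis by simp
  qed
  then show ?thesis by (intro that[of G] G_bound) (simp_all add: Cs_def)
qed


section \<open>Lower bounds for polynomial norms persist under exponential weights\<close>

text \<open>The mean value property: the powers of \<open>z\<close> other than the constant one integrate to
  zero.\<close>

lemma integral_circle_haar_poly: "(\<integral>\<theta>. poly G (cis \<theta>) \<partial>circle_haar) = poly G 0"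
proof -
  have "(\<integral>\<theta>. poly G (cis \<theta>) \<partial>circle_haar) = (\<Sum>k\<le>degree G. coeff G k * (\<integral>\<theta>. cis \<theta> ^ k \<partial>circle_haar))"
    unfolding poly_altdef
    by (subst Bochner_Integration.integral_sum)
       (auto intro!: integrable_mult_right circle_measure_integrable_continuous circle_measure_haar continuous_intros)
  also have "\<dots> = (\<Sum>k\<le>degree G. if k = 0 then coeff G 0 else 0)"
    using integral_circle_haar_orthonormal[of 0 0]
    by (intro sum.cong) (auto simp: integral_circle_haar_cis_power)
  also have "\<dots> = poly G 0" by (simp add: poly_0_coeff_0)
  finally show ?thesis .
qed

text \<open>Taylor polynomials of \<open>exp G\<close> in the variable \<open>G\<close>.  Their value at \<open>0\<close> is exactly
  \<open>1\<close> when \<open>G\<close> vanishes at \<open>0\<close>, so they stay admissible for the extremal problem.\<close>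

definition exp_poly :: "nat \<Rightarrow> complex poly \<Rightarrow> complex poly" where
  "exp_poly n G = (\<Sum>k<n. smult (1 / fact k) (G ^ k))"

lemma poly_exp_poly: "poly (exp_poly n G) z = (\<Sum>k<n. poly G z ^ k / fact k)"
  by (simp add: exp_poly_def poly_sum)

lemma poly_exp_poly_tendsto: "(\<lambda>n. poly (exp_poly n G) z) \<longlonglongrightarrow> exp (poly G z)"
  using exp_converges[of "poly G z"]
  by (simp add: poly_exp_poly sums_def scaleR_conv_of_real field_simps)

lemma norm_poly_exp_poly: "cmod (poly (exp_poly n G) z) \<le> exp (cmod (poly G z))"
proof -
  have "cmod (poly (exp_poly n G) z) \<le> (\<Sum>k<n. cmod (poly G z) ^ k /\<^sub>R fact k)"
    unfolding poly_exp_poly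
    by (rule sum_norm_le) (simp add: norm_divide norm_power field_simps)
  also have "\<dots> \<le> (\<Sum>k. cmod (poly G z) ^ k /\<^sub>R fact k)"
    using sums_summable[OF exp_converges[of "cmod (poly G z)"]] by (intro sum_le_suminf) auto
  also have "\<dots> = exp (cmod (poly G z))" by (simp add: exp_def)
  finally show ?thesis .
qed

lemma poly_exp_poly_0: "poly G 0 = 0 \<Longrightarrow> 0 < n \<Longrightarrow> poly (exp_poly n G) 0 = 1"
proof -
  assume G: "poly G 0 = 0" and n: "0 < n"
  have "poly (exp_poly n G) 0 = (\<Sum>k<n. if k = 0 then 1 else 0)"
    unfolding poly_exp_poly by (intro sum.cong) (auto simp: G)
  then show ?thesis using n by simp
qed

lemma cmod_exp_half: "(cmod (exp (z / 2)))\<^sup>2 = exp (Re z)"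
  by (simp add: exp_double[symmetric])

text \<open>The hypothesis is applied to \<open>P\<close> times the Taylor polynomials of
  \<open>exp (G / 2)\<close>, and \<open>\<bar>exp (G / 2)\<bar>\<^sup>2 = exp (Re G)\<close>.\<close>

lemma szego_bound_exp_poly_normalized:
  assumes \<nu>: "circle_measure \<nu>"
    and s: "\<And>Q. poly Q 0 = 1 \<Longrightarrow> s \<le> (\<integral>\<theta>. (cmod (poly Q (cis \<theta>)))\<^sup>2 \<partial>\<nu>)"
    and P: "poly P 0 = 1" and G: "poly G 0 = 0"
  shows "s \<le> (\<integral>\<theta>. (cmod (poly P (cis \<theta>)))\<^sup>2 * exp (Re (poly G (cis \<theta>))) \<partial>\<nu>)"
proof -
  interpret finite_measure \<nu> using \<nu> by (simp add: circle_measure_def)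
  define H where "H = smult (1 / 2) G"
  have pH: "poly H z = poly G z / 2" for z by (simp add: H_def)
  define Q where "Q n = P * exp_poly n H" for n
  have meas: "(\<lambda>\<theta>. f (cis \<theta>)) \<in> borel_measurable \<nu>" if "continuous_on UNIV f" for f :: "complex \<Rightarrow> real"
    using circle_measure_integrable_continuous[OF \<nu> that] by simp
  have "(\<lambda>n. \<integral>\<theta>. (cmod (poly (Q n) (cis \<theta>)))\<^sup>2 \<partial>\<nu>)
      \<longlonglongrightarrow> (\<integral>\<theta>. (cmod (poly P (cis \<theta>)))\<^sup>2 * exp (Re (poly G (cis \<theta>))) \<partial>\<nu>)"
  proof (rule integral_dominated_convergence[where w = "\<lambda>\<theta>. (cmod (poly P (cis \<theta>)) * exp (cmod (poly H (cis \<theta>))))\<^sup>2"])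
    show "AE \<theta> in \<nu>. (\<lambda>n. (cmod (poly (Q n) (cis \<theta>)))\<^sup>2)
        \<longlonglongrightarrow> (cmod (poly P (cis \<theta>)))\<^sup>2 * exp (Re (poly G (cis \<theta>)))"
    proof (rule AE_I2)
      fix \<theta>
      have "(\<lambda>n. (cmod (poly (Q n) (cis \<theta>)))\<^sup>2) \<longlonglongrightarrow> (cmod (poly P (cis \<theta>) * exp (poly H (cis \<theta>))))\<^sup>2"
        unfolding Q_def poly_mult by (intro tendsto_intros poly_exp_poly_tendsto)
      then show "(\<lambda>n. (cmod (poly (Q n) (cis \<theta>)))\<^sup>2)
          \<longlonglongrightarrow> (cmod (poly P (cis \<theta>)))\<^sup>2 * exp (Re (poly G (cis \<theta>)))"
        unfolding norm_mult power_mult_distrib pH cmod_exp_half .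
    qed
    show "AE \<theta> in \<nu>. norm ((cmod (poly (Q n) (cis \<theta>)))\<^sup>2) \<le> (cmod (poly P (cis \<theta>)) * exp (cmod (poly H (cis \<theta>))))\<^sup>2" for n
      unfolding Q_def poly_mult norm_mult
      by (intro AE_I2) (auto intro!: power_mono mult_left_mono norm_poly_exp_poly simp: abs_mult)
    show "integrable \<nu> (\<lambda>\<theta>. (cmod (poly P (cis \<theta>)) * exp (cmod (poly H (cis \<theta>))))\<^sup>2)"
      by (rule circle_measure_integrable_continuous[OF \<nu>]) (intro continuous_intros)
    show "(\<lambda>\<theta>. (cmod (poly P (cis \<theta>)))\<^sup>2 * exp (Re (poly G (cis \<theta>)))) \<in> borel_measurable \<nu>"
      by (rule meas) (intro continuous_intros)
    show "(\<lambda>\<theta>. (cmod (poly (Q n) (cis \<theta>)))\<^sup>2) \<in> borel_measurable \<nu>" for n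
      by (rule meas) (intro continuous_intros)
  qed
  moreover have "s \<le> (\<integral>\<theta>. (cmod (poly (Q n) (cis \<theta>)))\<^sup>2 \<partial>\<nu>)" if "1 \<le> n" for n
    using that P G by (intro s) (simp add: Q_def poly_exp_poly_0 pH)
  ultimately show ?thesis by (intro LIMSEQ_le_const[of _ _ s]) auto
qed

text \<open>The mean value of \<open>Re G\<close> is \<open>Re (G 0)\<close>, so subtracting the constant term of \<open>G\<close>
  reduces the claim to the normalized case.\<close>

lemma szego_bound_exp_poly:
  assumes \<nu>: "circle_measure \<nu>"
    and s: "\<And>Q. poly Q 0 = 1 \<Longrightarrow> s \<le> (\<integral>\<theta>. (cmod (poly Q (cis \<theta>)))\<^sup>2 \<partial>\<nu>)"
    and P: "poly P 0 = 1"
  shows "s * exp (\<integral>\<theta>. Re (poly G (cis \<theta>)) \<partial>circle_haar)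
     \<le> (\<integral>\<theta>. (cmod (poly P (cis \<theta>)))\<^sup>2 * exp (Re (poly G (cis \<theta>))) \<partial>\<nu>)"
proof -
  have int: "integrable circle_haar (\<lambda>\<theta>. poly G (cis \<theta>))"
    by (rule circle_measure_integrable_continuous[OF circle_measure_haar]) (intro continuous_intros)
  have mean: "(\<integral>\<theta>. Re (poly G (cis \<theta>)) \<partial>circle_haar) = Re (poly G 0)"
    using int by (simp add: integral_circle_haar_poly)
  define G' where "G' = G - [:poly G 0:]"
  have "s \<le> (\<integral>\<theta>. (cmod (poly P (cis \<theta>)))\<^sup>2 * exp (Re (poly G' (cis \<theta>))) \<partial>\<nu>)"
    by (rule szego_bound_exp_poly_normalized[OF \<nu> s P]) (auto simp: G'_def)
  also have "\<dots> = (\<integral>\<theta>. (cmod (poly P (cis \<theta>)))\<^sup>2 * exp (Re (poly G (cis \<theta>))) * inverse (exp (Re (poly G 0))) \<partial>\<nu>)"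
    by (simp add: G'_def exp_diff field_simps)
  also have "\<dots> = (\<integral>\<theta>. (cmod (poly P (cis \<theta>)))\<^sup>2 * exp (Re (poly G (cis \<theta>))) \<partial>\<nu>) * inverse (exp (Re (poly G 0)))"
    by (rule Bochner_Integration.integral_mult_left_zero)
  finally show ?thesis unfolding mean by (simp add: field_simps)
qed

lemma exp_Lipschitz:
  fixes a b c :: real
  assumes "a \<le> c" "b \<le> c"
  shows "\<bar>exp a - exp b\<bar> \<le> exp c * \<bar>a - b\<bar>"
proof -
  have *: "exp y - exp x \<le> exp c * \<bar>x - y\<bar>" if "y \<le> c" for x y
  proof -
    have "exp y * (1 + (x - y)) \<le> exp y * exp (x - y)"
      by (intro mult_left_mono exp_ge_add_one_self) auto
    then have "exp y - exp x \<le> exp y * (y - x)" by (simp add: exp_diff algebra_simps)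
    also have "\<dots> \<le> exp y * \<bar>x - y\<bar>" by (intro mult_left_mono) auto
    also have "\<dots> \<le> exp c * \<bar>x - y\<bar>" using that by (intro mult_right_mono) auto
    finally show ?thesis .
  qed
  from *[OF assms(1), of b] *[OF assms(2), of a] show ?thesis by (simp add: abs_minus_commute abs_le_iff)
qed

text \<open>Both sides depend continuously on \<open>h\<close>, the left one in \<open>L\<^sup>1(m)\<close> and the right one
  in \<open>L\<^sup>1(\<nu>)\<close> as long as \<open>h\<close> stays bounded, because the exponential function is Lipschitz on bounded
  intervals.\<close>

lemma szego_bound_exp_borel:
  assumes \<nu>: "circle_measure \<nu>"
    and s: "\<And>Q. poly Q 0 = 1 \<Longrightarrow> s \<le> (\<integral>\<theta>. (cmod (poly Q (cis \<theta>)))\<^sup>2 \<partial>\<nu>)"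
    and P: "poly P 0 = 1"
    and h: "h \<in> borel_measurable circle_borel" and B: "\<And>\<theta>. \<theta> \<in> {0..<2 * pi} \<Longrightarrow> \<bar>h \<theta>\<bar> \<le> B"
  shows "s * exp (\<integral>\<theta>. h \<theta> \<partial>circle_haar) \<le> (\<integral>\<theta>. (cmod (poly P (cis \<theta>)))\<^sup>2 * exp (h \<theta>) \<partial>\<nu>)"
proof -
  define good where "good n G \<longleftrightarrow> (\<forall>\<theta>. \<bar>Re (poly G (cis \<theta>))\<bar> \<le> B + 1) \<and>
     (\<integral>\<theta>. \<bar>h \<theta> - Re (poly G (cis \<theta>))\<bar> \<partial>\<nu>) < 1 / real (Suc n) \<and>
     (\<integral>\<theta>. \<bar>h \<theta> - Re (poly G (cis \<theta>))\<bar> \<partial>circle_haar) < 1 / real (Suc n)" for n G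
  have "\<exists>G. good n G" for n
  proof -
    have "0 < 1 / real (Suc n)" by simp
    from bounded_borel_approx_Re_poly[OF \<nu> h B this] show ?thesis unfolding good_def by blast
  qed
  then obtain G where "\<And>n. good n (G n)" by metis
  then have G: "\<And>n \<theta>. \<bar>Re (poly (G n) (cis \<theta>))\<bar> \<le> B + 1"
     "\<And>n. (\<integral>\<theta>. \<bar>h \<theta> - Re (poly (G n) (cis \<theta>))\<bar> \<partial>\<nu>) < 1 / real (Suc n)"
     "\<And>n. (\<integral>\<theta>. \<bar>h \<theta> - Re (poly (G n) (cis \<theta>))\<bar> \<partial>circle_haar) < 1 / real (Suc n)"
    unfolding good_def by blast+
  define g where "g n \<theta> = Re (poly (G n) (cis \<theta>))" for n \<theta>
  have gB: "\<bar>g n \<theta>\<bar> \<le> B + 1" for n \<theta> using G(1) by (simp add: g_def)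
  have g_cb: "g n \<in> borel_measurable circle_borel" for n
    unfolding g_def by (rule measurable_circle[OF refl])
      (auto intro!: borel_measurable_continuous_onI continuous_intros)
  have hB: "\<bar>h \<theta>\<bar> \<le> B + 1" if "\<theta> \<in> {0..<2 * pi}" for \<theta> using B[OF that] by simp
  have int_h: "integrable M h" if "circle_measure M" for M
    using that h hB by (intro circle_measure_integrable_bounded[where B = "B + 1"]) auto
  have int_g: "integrable M (g n)" if "circle_measure M" for M n
    using that g_cb gB by (intro circle_measure_integrable_bounded[where B = "B + 1"]) auto
  have null: "(\<lambda>n. 1 / real (Suc n)) \<longlonglongrightarrow> 0" using LIMSEQ_inverse_real_of_nat by (simp add: field_simps)
  have lim1: "(\<lambda>n. \<integral>\<theta>. g n \<theta> \<partial>circle_haar) \<longlonglongrightarrow> (\<integral>\<theta>. h \<theta> \<partial>circle_haar)"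
  proof (rule LIM_zero_cancel, rule Lim_null_comparison[OF _ null])
    have "norm ((\<integral>\<theta>. g n \<theta> \<partial>circle_haar) - (\<integral>\<theta>. h \<theta> \<partial>circle_haar)) \<le> 1 / real (Suc n)" for n
    proof -
      have "(\<integral>\<theta>. g n \<theta> \<partial>circle_haar) - (\<integral>\<theta>. h \<theta> \<partial>circle_haar) = (\<integral>\<theta>. g n \<theta> - h \<theta> \<partial>circle_haar)"
        using int_g int_h circle_measure_haar by simp
      also have "norm \<dots> \<le> (\<integral>\<theta>. norm (g n \<theta> - h \<theta>) \<partial>circle_haar)" by (rule integral_norm_bound)
      also have "\<dots> \<le> 1 / real (Suc n)" using G(3)[of n] by (simp add: g_def abs_minus_commute)
      finally show ?thesis .
    qed
    then show "\<forall>\<^sub>F n in sequentially. norm ((\<integral>\<theta>. g n \<theta> \<partial>circle_haar) - (\<integral>\<theta>. h \<theta> \<partial>circle_haar)) \<le> 1 / real (Suc n)"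
      by simp
  qed
  have "compact ((\<lambda>z. (cmod (poly P z))\<^sup>2) ` sphere 0 1)"
    by (intro compact_continuous_image continuous_intros) auto
  then obtain C where "\<forall>z\<in>sphere 0 1. (cmod (poly P z))\<^sup>2 \<le> C"
    by (auto dest!: compact_imp_bounded simp: bounded_iff)
  then have C: "(cmod (poly P z))\<^sup>2 \<le> C" if "cmod z = 1" for z using that by simp
  have C0: "0 \<le> C" using order_trans[OF zero_le_power2 C[of 1]] by simp
  have P_cb: "(\<lambda>\<theta>. (cmod (poly P (cis \<theta>)))\<^sup>2) \<in> borel_measurable circle_borel"
    by (rule measurable_circle[OF refl]) (auto intro!: borel_measurable_continuous_onI continuous_intros)
  have int_P: "integrable \<nu> (\<lambda>\<theta>. (cmod (poly P (cis \<theta>)))\<^sup>2 * exp (k \<theta>))"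
    if "k \<in> borel_measurable circle_borel" "\<And>\<theta>. \<theta> \<in> {0..<2 * pi} \<Longrightarrow> \<bar>k \<theta>\<bar> \<le> B + 1" for k
  proof (rule circle_measure_integrable_bounded[OF \<nu>, where B = "C * exp (B + 1)"])
    show "(\<lambda>\<theta>. (cmod (poly P (cis \<theta>)))\<^sup>2 * exp (k \<theta>)) \<in> borel_measurable circle_borel"
      using P_cb that(1) by measurable
    fix x assume "x \<in> {0..<2 * pi}"
    then have "k x \<le> B + 1" using that(2)[of x] by auto
    then show "norm ((cmod (poly P (cis x)))\<^sup>2 * exp (k x)) \<le> C * exp (B + 1)"
      using C[of "cis x"] C0 by (auto simp: abs_mult intro!: mult_mono)
  qed
  define K where "K = C * exp (B + 1)"
  have K0: "0 \<le> K" using C0 by (simp add: K_def)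
  let ?I = "\<lambda>k. \<integral>\<theta>. (cmod (poly P (cis \<theta>)))\<^sup>2 * exp (k \<theta>) \<partial>\<nu>"
  have "\<bar>?I (g n) - ?I h\<bar> \<le> K * (1 / real (Suc n))" for n
  proof -
    have "?I (g n) - ?I h = (\<integral>\<theta>. (cmod (poly P (cis \<theta>)))\<^sup>2 * (exp (g n \<theta>) - exp (h \<theta>)) \<partial>\<nu>)"
      using int_P[OF g_cb gB, of n] int_P[OF h hB] by (simp add: right_diff_distrib)
    also have "\<bar>\<dots>\<bar> \<le> (\<integral>\<theta>. \<bar>(cmod (poly P (cis \<theta>)))\<^sup>2 * (exp (g n \<theta>) - exp (h \<theta>))\<bar> \<partial>\<nu>)"
      by (rule integral_abs_bound)
    also have "\<dots> \<le> (\<integral>\<theta>. K * \<bar>h \<theta> - g n \<theta>\<bar> \<partial>\<nu>)"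
    proof (rule integral_mono)
      show "integrable \<nu> (\<lambda>\<theta>. \<bar>(cmod (poly P (cis \<theta>)))\<^sup>2 * (exp (g n \<theta>) - exp (h \<theta>))\<bar>)"
        using int_P[OF g_cb gB, of n] int_P[OF h hB] by (simp add: right_diff_distrib)
      show "integrable \<nu> (\<lambda>\<theta>. K * \<bar>h \<theta> - g n \<theta>\<bar>)" using int_g int_h \<nu> by simp
      fix \<theta> assume "\<theta> \<in> space \<nu>"
      then have "\<theta> \<in> {0..<2 * pi}" using circle_measure_space[OF \<nu>] by simp
      then have "\<bar>exp (g n \<theta>) - exp (h \<theta>)\<bar> \<le> exp (B + 1) * \<bar>g n \<theta> - h \<theta>\<bar>"
        using gB[of n \<theta>] hB[of \<theta>] by (intro exp_Lipschitz) auto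
      then have "(cmod (poly P (cis \<theta>)))\<^sup>2 * \<bar>exp (g n \<theta>) - exp (h \<theta>)\<bar> \<le> C * (exp (B + 1) * \<bar>g n \<theta> - h \<theta>\<bar>)"
        using C[of "cis \<theta>"] C0 by (intro mult_mono) auto
      then show "\<bar>(cmod (poly P (cis \<theta>)))\<^sup>2 * (exp (g n \<theta>) - exp (h \<theta>))\<bar> \<le> K * \<bar>h \<theta> - g n \<theta>\<bar>"
        by (simp add: K_def abs_mult abs_minus_commute mult.assoc)
    qed
    also have "\<dots> = K * (\<integral>\<theta>. \<bar>h \<theta> - g n \<theta>\<bar> \<partial>\<nu>)" by simp
    also have "\<dots> \<le> K * (1 / real (Suc n))"
      using G(2)[of n] K0 by (intro mult_left_mono) (auto simp: g_def)
    finally show ?thesis .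
  qed
  then have "(\<lambda>n. ?I (g n) - ?I h) \<longlonglongrightarrow> 0"
    by (intro Lim_null_comparison[OF _ tendsto_mult_right_zero[OF null, of K]]) auto
  then have lim2: "(\<lambda>n. ?I (g n)) \<longlonglongrightarrow> ?I h" by (rule LIM_zero_cancel)
  have "(\<lambda>n. s * exp (\<integral>\<theta>. g n \<theta> \<partial>circle_haar)) \<longlonglongrightarrow> s * exp (\<integral>\<theta>. h \<theta> \<partial>circle_haar)"
    by (intro tendsto_intros lim1)
  then show ?thesis
  proof (rule LIMSEQ_le[OF _ lim2])
    show "\<exists>N. \<forall>n\<ge>N. s * exp (\<integral>\<theta>. g n \<theta> \<partial>circle_haar) \<le> ?I (g n)"
      unfolding g_def using szego_bound_exp_poly[OF \<nu> s P] by blast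
  qed
qed


section \<open>The geometric mean as a limit of truncations\<close>

text \<open>The logarithm cut off at \<open>\<plusminus> n\<close>; zero and infinite densities become finite values.\<close>

definition trunc_ln :: "nat \<Rightarrow> ennreal \<Rightarrow> real" where
  "trunc_ln n x = real_of_ereal (max (- ereal (real n)) (min (ereal (real n)) (ln_ennreal x)))"

lemma trunc_ln_simps:
  "trunc_ln n 0 = - real n"
  "trunc_ln n top = real n"
  "0 < r \<Longrightarrow> trunc_ln n (ennreal r) = max (- real n) (min (real n) (ln r))"
  by (auto simp: trunc_ln_def ln_ennreal_def ereal_max[symmetric] ereal_min[symmetric] simp del: ereal_max ereal_min)

lemma ennreal_zero_top_pos_cases [case_names zero top pos]:
  assumes "x = 0 \<Longrightarrow> P" "x = top \<Longrightarrow> P" "\<And>r. x = ennreal r \<Longrightarrow> 0 < r \<Longrightarrow> P"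
  shows P
proof (cases x)
  case (real r)
  then show ?thesis using assms(1,3) by (cases "r = 0") auto
qed (use assms in auto)

lemma trunc_ln_bound: "\<bar>trunc_ln n x\<bar> \<le> real n"
  by (cases x rule: ennreal_zero_top_pos_cases) (auto simp: trunc_ln_simps)

text \<open>Truncation from above decreases the exponential; truncation from below adds at most
  \<open>exp (- n)\<close>.\<close>

lemma exp_trunc_ln_le: "ennreal (exp (trunc_ln n x)) \<le> x + ennreal (exp (- real n))"
proof (cases x rule: ennreal_zero_top_pos_cases)
  case (pos r)
  have "exp (max (- real n) (min (real n) (ln r))) \<le> r + exp (- real n)"
  proof (cases "ln r \<le> - real n")
    case True
    then have "max (- real n) (min (real n) (ln r)) = - real n"
      by (simp add: max_absorb1 min.coboundedI2)
    then show ?thesis using pos by simp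
  next
    case False
    then have "exp (max (- real n) (min (real n) (ln r))) \<le> exp (ln r)" by simp
    then show ?thesis using pos by (simp add: add_increasing2)
  qed
  then show ?thesis using pos by (simp add: trunc_ln_simps ennreal_plus[symmetric] ennreal_leI del: ennreal_plus)
qed (auto simp: trunc_ln_simps)

text \<open>The product is at most \<open>1\<close> unless \<open>x > exp n\<close>, when truncation from above
  leaves \<open>x * exp (- n)\<close>.\<close>

lemma mult_exp_minus_trunc_ln_le:
  "x * ennreal (exp (- trunc_ln n x)) \<le> 1 + x * ennreal (exp (- real n))"
proof (cases x rule: ennreal_zero_top_pos_cases)
  case (pos r)
  have "r * exp (- max (- real n) (min (real n) (ln r))) \<le> 1 + r * exp (- real n)"
  proof (cases "ln r \<le> real n")
    case True
    then have "exp (- max (- real n) (min (real n) (ln r))) \<le> exp (- ln r)" by simp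
    also have "\<dots> = inverse r" using pos by (simp add: exp_minus)
    finally have "r * exp (- max (- real n) (min (real n) (ln r))) \<le> r * inverse r"
      using pos by (intro mult_left_mono) auto
    then show ?thesis using pos by (simp add: add_increasing2)
  next
    case False
    then show ?thesis by simp
  qed
  then show ?thesis using pos
    by (simp add: trunc_ln_simps ennreal_leI flip: ennreal_mult ennreal_plus ennreal_1)
qed (auto simp: trunc_ln_simps ennreal_top_mult ennreal_mult_top)

lemma trunc_ln_eq_diff:
  "trunc_ln n x = enn2real (min (of_nat n) (e2ennreal (ln_ennreal x))) - enn2real (min (of_nat n) (e2ennreal (- ln_ennreal x)))"
proof (cases x rule: ennreal_zero_top_pos_cases)
  case (pos r)
  have 1: "enn2real (min (of_nat n) (ennreal t)) = max 0 (min (real n) t)" for t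
    by (cases "0 \<le> t") (auto simp: ennreal_of_nat_eq_real_of_nat min_def max_def ennreal_neg)
  have "ln_ennreal x = ereal (ln r)" using pos by (simp add: ln_ennreal_def)
  then show ?thesis using pos by (auto simp: trunc_ln_simps e2ennreal_ereal 1)
qed (auto simp: trunc_ln_simps ln_ennreal_def e2ennreal_infty e2ennreal_neg)

lemma ln_ennreal_measurable [measurable]: "ln_ennreal \<in> borel_measurable borel"
  unfolding ln_ennreal_def[abs_def] by measurable

lemma trunc_ln_measurable [measurable]: "trunc_ln n \<in> borel_measurable borel"
  unfolding trunc_ln_def[abs_def] by measurable

lemma e2ennreal_ln_ennreal_le: "e2ennreal (ln_ennreal x) \<le> x"
proof (cases x rule: ennreal_zero_top_pos_cases)
  case (pos r)
  have "ln r \<le> r" using pos ln_bound by blast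
  then show ?thesis using pos by (simp add: ln_ennreal_def e2ennreal_ereal ennreal_leI)
qed (auto simp: ln_ennreal_def e2ennreal_neg)

text \<open>The positive and the negative part of the truncated logarithm increase to
  those of \<open>ln_ennreal (w x)\<close>, and the integral of the positive one stays finite because
  \<open>ln x \<le> x\<close> and \<open>w\<close> is integrable.  If the integral of the negative one is infinite, the
  exponentials tend to \<open>0\<close>, in agreement with \<open>exp_ereal (- \<infinity>) = 0\<close>.\<close>

lemma geometric_mean_limit:
  assumes "prob_space M" and w [measurable]: "w \<in> borel_measurable M" and fin: "(\<integral>\<^sup>+x. w x \<partial>M) < \<infinity>"
  obtains L where "0 \<le> L" "exp_ereal (ereal_integral M (\<lambda>x. ln_ennreal (w x))) = ereal L"
    "(\<lambda>n. exp (\<integral>x. trunc_ln n (w x) \<partial>M)) \<longlonglongrightarrow> L"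
proof -
  interpret prob_space M by fact
  define u where "u x = e2ennreal (ln_ennreal (w x))" for x
  define v where "v x = e2ennreal (- ln_ennreal (w x))" for x
  have [measurable]: "u \<in> borel_measurable M" "v \<in> borel_measurable M"
    unfolding u_def v_def by measurable
  define A where "A = (\<integral>\<^sup>+x. u x \<partial>M)"
  define B where "B = (\<integral>\<^sup>+x. v x \<partial>M)"
  have lim: "(\<lambda>n. \<integral>\<^sup>+x. min (of_nat n) (k x) \<partial>M) \<longlonglongrightarrow> (\<integral>\<^sup>+x. k x \<partial>M)"
    if [measurable]: "k \<in> borel_measurable M" for k :: "'a \<Rightarrow> ennreal"
  proof (rule nn_integral_LIMSEQ)
    show "incseq (\<lambda>n x. min (of_nat n) (k x))"
      unfolding incseq_def le_fun_def by (intro allI impI min.mono of_nat_mono order_refl)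
    show "(\<lambda>n. min (of_nat n) (k x)) \<longlonglongrightarrow> k x" for x
    proof -
      have "(\<lambda>n. min (of_nat n) (k x)) \<longlonglongrightarrow> min top (k x)"
        by (intro tendsto_min tendsto_const of_nat_tendsto_top_ennreal)
      then show ?thesis by simp
    qed
  qed simp_all
  have fin_min: "(\<integral>\<^sup>+x. min (of_nat n) (k x) \<partial>M) \<le> of_nat n" for n and k :: "'a \<Rightarrow> ennreal"
    using nn_integral_mono[of M "\<lambda>x. min (of_nat n) (k x)" "\<lambda>_. of_nat n"]
    by (simp add: emeasure_space_1)
  have fin_top: "(\<integral>\<^sup>+x. min (of_nat n) (k x) \<partial>M) < top" for n and k :: "'a \<Rightarrow> ennreal"
    using fin_min by (rule le_less_trans) (simp add: of_nat_less_top)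
  have int: "integrable M (\<lambda>x. enn2real (min (of_nat n) (k x)))"
    "(\<integral>x. enn2real (min (of_nat n) (k x)) \<partial>M) = enn2real (\<integral>\<^sup>+x. min (of_nat n) (k x) \<partial>M)"
    if [measurable]: "k \<in> borel_measurable M" for n and k :: "'a \<Rightarrow> ennreal"
  proof -
    have le: "min (of_nat n) (k x) < top" for x by (simp add: min_less_iff_disj of_nat_less_top)
    have "enn2real (min (of_nat n) (k x)) \<le> real n" for x
      using enn2real_mono[of "min (of_nat n) (k x)" "of_nat n"] by (simp add: of_nat_less_top)
    then show "integrable M (\<lambda>x. enn2real (min (of_nat n) (k x)))"
      by (intro integrable_const_bound[where B = "real n"]) auto
    show "(\<integral>x. enn2real (min (of_nat n) (k x)) \<partial>M) = enn2real (\<integral>\<^sup>+x. min (of_nat n) (k x) \<partial>M)"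
      by (subst integral_eq_nn_integral) (auto simp: le)
  qed
  define a where "a n = enn2real (\<integral>\<^sup>+x. min (of_nat n) (u x) \<partial>M)" for n
  define b where "b n = enn2real (\<integral>\<^sup>+x. min (of_nat n) (v x) \<partial>M)" for n
  have eq: "(\<integral>x. trunc_ln n (w x) \<partial>M) = a n - b n" for n
    unfolding trunc_ln_eq_diff a_def b_def u_def[symmetric] v_def[symmetric]
    by (subst Bochner_Integration.integral_diff) (auto simp: int)
  have "A \<le> (\<integral>\<^sup>+x. w x \<partial>M)" unfolding A_def u_def
    by (intro nn_integral_mono e2ennreal_ln_ennreal_le)
  then have A: "A < top" using fin by (auto simp: less_top)
  have a: "a \<longlonglongrightarrow> enn2real A"
    unfolding a_def using lim[of u] A by (intro tendsto_enn2real) (simp_all add: A_def)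
  have ei: "ereal_integral M (\<lambda>x. ln_ennreal (w x)) = enn2ereal A - enn2ereal B"
    by (simp add: ereal_integral_def A_def B_def u_def v_def)
  have A': "enn2ereal A = ereal (enn2real A)" using A by (cases A) (auto simp: enn2ereal_ennreal)
  show ?thesis
  proof (cases "B = top")
    case True
    have "(\<lambda>n. ennreal (b n)) \<longlonglongrightarrow> top"
      using lim[of v] fin_top[of _ v] True by (simp add: b_def B_def less_top)
    then have "filterlim b at_top sequentially"
      unfolding ennreal_tendsto_top_eq_at_top .
    then have "filterlim (\<lambda>n. - (a n) + b n) at_top sequentially"
      by (intro filterlim_tendsto_add_at_top[OF tendsto_minus[OF a]])
    then have "filterlim (\<lambda>n. - (- (a n) + b n)) at_bot sequentially"
      by (simp add: filterlim_uminus_at_top)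
    then have "filterlim (\<lambda>n. a n - b n) at_bot sequentially" by simp
    then have "(\<lambda>n. exp (a n - b n)) \<longlonglongrightarrow> 0"
      by (rule filterlim_compose[OF exp_at_bot])
    moreover have "exp_ereal (ereal_integral M (\<lambda>x. ln_ennreal (w x))) = ereal 0"
      using True A' by (simp add: ei exp_ereal_def)
    ultimately show ?thesis using that[of 0] by (simp add: eq)
  next
    case False
    then have B: "B < top" by (simp add: less_top)
    have b: "b \<longlonglongrightarrow> enn2real B"
      unfolding b_def using lim[of v] B by (intro tendsto_enn2real) (simp_all add: B_def)
    have B': "enn2ereal B = ereal (enn2real B)" using B by (cases B) (auto simp: enn2ereal_ennreal)
    have "exp_ereal (ereal_integral M (\<lambda>x. ln_ennreal (w x))) = ereal (exp (enn2real A - enn2real B))"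
      by (simp add: ei exp_ereal_def A' B')
    moreover have "(\<lambda>n. exp (a n - b n)) \<longlonglongrightarrow> exp (enn2real A - enn2real B)"
      by (intro tendsto_intros a b)
    ultimately show ?thesis using that[of "exp (enn2real A - enn2real B)"] by (simp add: eq)
  qed
qed


section \<open>Szego's theorem\<close>

text \<open>The Lebesgue decomposition without its singular part, which is absorbed in a Haar
  null set \<open>N\<close>: off \<open>N\<close> the measure \<open>\<mu>\<close> is given by its density.\<close>

lemma circle_measure_density:
  assumes \<mu>: "circle_measure \<mu>"
  defines "w \<equiv> RN_deriv circle_haar (ac_part circle_haar \<mu>)"
  obtains N where "N \<in> null_sets circle_haar" "w \<in> borel_measurable circle_haar"
    "\<And>A. A \<in> sets circle_borel \<Longrightarrow> emeasure (density circle_haar w) A \<le> emeasure \<mu> A"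
    "\<And>A. A \<in> sets circle_borel \<Longrightarrow> emeasure \<mu> (A - N) = emeasure (density circle_haar w) (A - N)"
proof -
  interpret prob_space circle_haar by (rule prob_space_circle_haar)
  define a where "a = ac_part circle_haar \<mu>"
  have sets_\<mu>: "sets \<mu> = sets circle_haar" "finite_measure \<mu>"
    using \<mu> by (simp_all add: circle_measure_def)
  obtain \<mu>s where d: "lebesgue_decomposition circle_haar \<mu> a \<mu>s"
    using lebesgue_decomposition_ac_part[OF sets_\<mu>(2,1)] by (auto simp: a_def)
  have sets: "sets a = sets circle_haar" "sets \<mu>s = sets circle_haar"
    and sum: "\<And>A. A \<in> sets circle_haar \<Longrightarrow> emeasure \<mu> A = emeasure a A + emeasure \<mu>s A"
    and ac: "absolutely_continuous circle_haar a"
    using d sets_\<mu> by (auto simp: lebesgue_decomposition_def)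
  have dens: "density circle_haar w = a"
    unfolding w_def a_def[symmetric] using ac sets(1) by (rule density_RN_deriv)
  obtain N where N: "N \<in> null_sets circle_haar" "emeasure \<mu>s (space \<mu>s - N) = 0"
    using d by (auto simp: lebesgue_decomposition_def mutually_singular_def null_sets_def)
  show ?thesis
  proof
    show "N \<in> null_sets circle_haar" by fact
    show "w \<in> borel_measurable circle_haar" by (simp add: w_def)
    fix A assume A: "A \<in> sets circle_borel"
    show "emeasure (density circle_haar w) A \<le> emeasure \<mu> A"
      using sum[of A] A by (simp add: dens)
    have AN: "A - N \<in> sets circle_haar" using A N by auto
    have "emeasure \<mu>s (A - N) \<le> emeasure \<mu>s (space \<mu>s - N)"
    proof (rule emeasure_mono)
      show "A - N \<subseteq> space \<mu>s - N" using A sets sets.sets_into_space[of A \<mu>s] by auto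
      show "space \<mu>s - N \<in> sets \<mu>s"
        using N(1) sets(2) by (metis null_setsD2 sets.Diff sets.top)
    qed
    then have "emeasure \<mu>s (A - N) = 0" using N(2) by simp
    then show "emeasure \<mu> (A - N) = emeasure (density circle_haar w) (A - N)"
      using sum[OF AN] by (simp add: dens)
  qed
qed

text \<open>Integrate \<open>\<bar>Q\<bar>\<^sup>2 \<ge> 2 * Re Q - 1\<close>; the mean of \<open>Q\<close> is \<open>Q(0)\<close>.\<close>

lemma integral_circle_haar_norm_poly_ge:
  assumes "poly Q 0 = 1"
  shows "1 \<le> (\<integral>\<theta>. (cmod (poly Q (cis \<theta>)))\<^sup>2 \<partial>circle_haar)"
proof -
  interpret prob_space circle_haar by (rule prob_space_circle_haar)
  note int = circle_measure_integrable_continuous[OF circle_measure_haar]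
  have int_Q: "integrable circle_haar (\<lambda>\<theta>. poly Q (cis \<theta>))"
    by (rule int) (intro continuous_intros)
  have "1 = (\<integral>\<theta>. 2 * Re (poly Q (cis \<theta>)) - 1 \<partial>circle_haar)"
    using int_Q assms by (simp add: integral_circle_haar_poly prob_space)
  also have "\<dots> \<le> (\<integral>\<theta>. (cmod (poly Q (cis \<theta>)))\<^sup>2 \<partial>circle_haar)"
  proof (rule integral_mono)
    show "integrable circle_haar (\<lambda>\<theta>. 2 * Re (poly Q (cis \<theta>)) - 1)" using int_Q by simp
    show "integrable circle_haar (\<lambda>\<theta>. (cmod (poly Q (cis \<theta>)))\<^sup>2)"
      by (rule int) (intro continuous_intros)
    fix \<theta>
    have "0 \<le> (Re (poly Q (cis \<theta>)) - 1)\<^sup>2 + (Im (poly Q (cis \<theta>)))\<^sup>2" by simp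
    then show "2 * Re (poly Q (cis \<theta>)) - 1 \<le> (cmod (poly Q (cis \<theta>)))\<^sup>2"
      unfolding cmod_power2 by (simp add: power2_diff)
  qed
  finally show ?thesis .
qed

text \<open>The geometric mean of the density of the absolutely continuous part is the greatest
  lower bound of \<open>\<integral> |P|\<^sup>2 d\<mu>\<close> over all polynomials \<open>P\<close> with \<open>P(0) = 1\<close>.  The theorem is phrased with
  lower bounds \<open>s\<close>, which is the form that positivity of the kernel produces.\<close>

theorem szego:
  assumes \<mu>: "circle_measure \<mu>"
  shows "(\<forall>P. poly P 0 = 1 \<longrightarrow> s \<le> (\<integral>\<theta>. (cmod (poly P (cis \<theta>)))\<^sup>2 \<partial>\<mu>)) \<longleftrightarrow>
    ereal s \<le> exp_ereal (ereal_integral circle_haar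
        (\<lambda>\<theta>. ln_ennreal (RN_deriv circle_haar (ac_part circle_haar \<mu>) \<theta>)))"
proof -
  interpret H: prob_space circle_haar by (rule prob_space_circle_haar)
  interpret \<mu>: finite_measure \<mu> using \<mu> by (simp add: circle_measure_def)
  have sets_\<mu>: "sets \<mu> = sets circle_borel" using \<mu> by (simp add: circle_measure_def)
  define w where "w = RN_deriv circle_haar (ac_part circle_haar \<mu>)"
  obtain N where N: "N \<in> null_sets circle_haar" and w_meas [measurable]: "w \<in> borel_measurable circle_haar"
    and le: "\<And>A. A \<in> sets circle_borel \<Longrightarrow> emeasure (density circle_haar w) A \<le> emeasure \<mu> A"
    and off_N: "\<And>A. A \<in> sets circle_borel \<Longrightarrow> emeasure \<mu> (A - N) = emeasure (density circle_haar w) (A - N)"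
    unfolding w_def using circle_measure_density[OF \<mu>] by blast
  have N_sets [measurable]: "N \<in> sets circle_borel" using N by auto
  define c where "c = measure \<mu> (space \<mu>)"
  have c: "emeasure \<mu> (space \<mu>) = ennreal c" by (simp add: c_def \<mu>.emeasure_eq_measure)
  have sp: "space \<mu> = space circle_haar" using sets_\<mu> by (intro sets_eq_imp_space_eq) simp
  have mass_w: "(\<integral>\<^sup>+\<theta>. w \<theta> \<partial>circle_haar) \<le> ennreal c"
  proof -
    have "(\<integral>\<^sup>+\<theta>. w \<theta> \<partial>circle_haar) = (\<integral>\<^sup>+\<theta>. w \<theta> * indicator (space circle_haar) \<theta> \<partial>circle_haar)"
      by (intro nn_integral_cong) auto
    also have "\<dots> = emeasure (density circle_haar w) (space circle_haar)"
      by (rule emeasure_density[symmetric, OF w_meas sets.top])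
    also have "\<dots> \<le> emeasure \<mu> (space \<mu>)" unfolding sp by (rule le) (metis sets.top sets_circle_haar)
    finally show ?thesis by (simp add: c)
  qed
  then have "(\<integral>\<^sup>+\<theta>. w \<theta> \<partial>circle_haar) < \<infinity>" by (rule le_less_trans) simp
  then obtain L where L: "exp_ereal (ereal_integral circle_haar (\<lambda>\<theta>. ln_ennreal (w \<theta>))) = ereal L"
    and lim: "(\<lambda>n. exp (\<integral>\<theta>. trunc_ln n (w \<theta>) \<partial>circle_haar)) \<longlonglongrightarrow> L"
    using geometric_mean_limit[OF prob_space_circle_haar w_meas] by blast
  have null: "(\<lambda>n. exp (- real n)) \<longlonglongrightarrow> 0"
    by (rule filterlim_compose[OF exp_at_bot filterlim_compose[OF filterlim_uminus_at_bot_at_top filterlim_real_sequentially]])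
  have h_meas [measurable]: "(\<lambda>\<theta>. trunc_ln n (w \<theta>)) \<in> borel_measurable circle_borel" for n
    using w_meas by (simp cong: measurable_cong_sets)
  show ?thesis
    unfolding w_def[symmetric] L ereal_less_eq
  proof (intro iffI allI impI)
    \<comment> \<open>Haar measure has the bound \<open>1\<close>; weighting it by the truncated density gives at most \<open>\<mu>\<close> plus
      a small multiple of Haar measure\<close>
    fix P assume sL: "s \<le> L" and P: "poly P 0 = (1 :: complex)"
    define p where "p \<theta> = (cmod (poly P (cis \<theta>)))\<^sup>2" for \<theta>
    have int_p: "integrable M p" if "circle_measure M" for M
      unfolding p_def by (rule circle_measure_integrable_continuous[OF that]) (intro continuous_intros)
    have p_meas [measurable]: "p \<in> borel_measurable circle_haar"
      using int_p[OF circle_measure_haar] by simp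
    have nn_p: "(\<integral>\<^sup>+\<theta>. ennreal (p \<theta>) \<partial>M) = ennreal (\<integral>\<theta>. p \<theta> \<partial>M)" if "circle_measure M" for M
      using int_p[OF that] by (rule nn_integral_eq_integral) (simp add: p_def)
    have "exp (\<integral>\<theta>. trunc_ln n (w \<theta>) \<partial>circle_haar) \<le> (\<integral>\<theta>. p \<theta> \<partial>\<mu>) + exp (- real n) * (\<integral>\<theta>. p \<theta> \<partial>circle_haar)" for n
    proof -
      have "1 * exp (\<integral>\<theta>. trunc_ln n (w \<theta>) \<partial>circle_haar) \<le> (\<integral>\<theta>. p \<theta> * exp (trunc_ln n (w \<theta>)) \<partial>circle_haar)"
        unfolding p_def
        by (rule szego_bound_exp_borel[OF circle_measure_haar integral_circle_haar_norm_poly_ge P h_meas trunc_ln_bound])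
      then have "ennreal (exp (\<integral>\<theta>. trunc_ln n (w \<theta>) \<partial>circle_haar)) \<le> ennreal (\<integral>\<theta>. p \<theta> * exp (trunc_ln n (w \<theta>)) \<partial>circle_haar)"
        by (simp add: ennreal_leI)
      also have "\<dots> \<le> (\<integral>\<^sup>+\<theta>. ennreal (p \<theta> * exp (trunc_ln n (w \<theta>))) \<partial>circle_haar)"
      proof (rule eq_refl, rule nn_integral_eq_integral[symmetric])
        have "integrable circle_haar (\<lambda>\<theta>. exp (real n) * p \<theta>)" using int_p[OF circle_measure_haar] by simp
        then show "integrable circle_haar (\<lambda>\<theta>. p \<theta> * exp (trunc_ln n (w \<theta>)))"
        proof (rule Bochner_Integration.integrable_bound)
          have "exp (trunc_ln n x) \<le> exp (real n)" for x using trunc_ln_bound[of n x] by simp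
          then show "AE \<theta> in circle_haar. norm (p \<theta> * exp (trunc_ln n (w \<theta>))) \<le> norm (exp (real n) * p \<theta>)"
            by (intro AE_I2) (auto simp: abs_mult p_def mult.commute intro!: mult_right_mono)
        qed measurable
      qed (simp add: p_def)
      also have "\<dots> \<le> (\<integral>\<^sup>+\<theta>. w \<theta> * ennreal (p \<theta>) + ennreal (exp (- real n)) * ennreal (p \<theta>) \<partial>circle_haar)"
      proof (rule nn_integral_mono)
        fix \<theta>
        have "ennreal (p \<theta> * exp (trunc_ln n (w \<theta>))) = ennreal (exp (trunc_ln n (w \<theta>))) * ennreal (p \<theta>)"
          by (simp add: p_def ennreal_mult mult.commute)
        also have "\<dots> \<le> (w \<theta> + ennreal (exp (- real n))) * ennreal (p \<theta>)"
          by (intro mult_right_mono exp_trunc_ln_le) simp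
        finally show "ennreal (p \<theta> * exp (trunc_ln n (w \<theta>))) \<le> w \<theta> * ennreal (p \<theta>) + ennreal (exp (- real n)) * ennreal (p \<theta>)"
          by (simp add: distrib_right)
      qed
      also have "\<dots> = (\<integral>\<^sup>+\<theta>. w \<theta> * ennreal (p \<theta>) \<partial>circle_haar) + ennreal (exp (- real n)) * (\<integral>\<^sup>+\<theta>. ennreal (p \<theta>) \<partial>circle_haar)"
        by (simp add: nn_integral_add nn_integral_cmult)
      also have "(\<integral>\<^sup>+\<theta>. w \<theta> * ennreal (p \<theta>) \<partial>circle_haar) = (\<integral>\<^sup>+\<theta>. ennreal (p \<theta>) \<partial>density circle_haar w)"
        by (simp add: nn_integral_density)
      also have "\<dots> \<le> (\<integral>\<^sup>+\<theta>. ennreal (p \<theta>) \<partial>\<mu>)"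
        using le by (intro nn_integral_mono_measure) (auto simp: sets_\<mu> le_measure)
      finally have "ennreal (exp (\<integral>\<theta>. trunc_ln n (w \<theta>) \<partial>circle_haar))
          \<le> ennreal (\<integral>\<theta>. p \<theta> \<partial>\<mu>) + ennreal (exp (- real n)) * ennreal (\<integral>\<theta>. p \<theta> \<partial>circle_haar)"
        unfolding nn_p[OF \<mu>] nn_p[OF circle_measure_haar] by (simp add: add_right_mono)
      moreover have "0 \<le> (\<integral>\<theta>. p \<theta> \<partial>M)" for M by (simp add: p_def)
      ultimately show ?thesis by (simp flip: ennreal_mult ennreal_plus)
    qed
    moreover have "(\<lambda>n. (\<integral>\<theta>. p \<theta> \<partial>\<mu>) + exp (- real n) * (\<integral>\<theta>. p \<theta> \<partial>circle_haar)) \<longlonglongrightarrow> (\<integral>\<theta>. p \<theta> \<partial>\<mu>) + 0 * (\<integral>\<theta>. p \<theta> \<partial>circle_haar)"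
      by (intro tendsto_intros null)
    ultimately have "L \<le> (\<integral>\<theta>. p \<theta> \<partial>\<mu>) + 0 * (\<integral>\<theta>. p \<theta> \<partial>circle_haar)"
      using lim by (intro LIMSEQ_le[of _ L]) auto
    then show "s \<le> (\<integral>\<theta>. (cmod (poly P (cis \<theta>)))\<^sup>2 \<partial>\<mu>)" using sL by (simp add: p_def)
  next
    assume s: "\<forall>P. poly P 0 = 1 \<longrightarrow> s \<le> (\<integral>\<theta>. (cmod (poly P (cis \<theta>)))\<^sup>2 \<partial>\<mu>)"
    have "s \<le> (1 + 2 * (exp (- real n) * c)) * exp (\<integral>\<theta>. trunc_ln n (w \<theta>) \<partial>circle_haar)" for n
    proof -
      \<comment> \<open>the weight \<open>exp h\<close> is nearly \<open>1 / w\<close> off \<open>N\<close> and suppresses the singular part on \<open>N\<close>\<close>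
      define h where "h \<theta> = (if \<theta> \<in> N then - real n else - trunc_ln n (w \<theta>))" for \<theta>
      have h [measurable]: "h \<in> borel_measurable circle_borel" unfolding h_def by measurable
      have hB: "\<bar>h \<theta>\<bar> \<le> real n" for \<theta> using trunc_ln_bound by (simp add: h_def)
      have h_haar [measurable]: "h \<in> borel_measurable circle_haar" using h by (simp cong: measurable_cong_sets)
      have off_N_sets [measurable]: "space \<mu> - N \<in> sets \<mu>"
        using N_sets sets_\<mu> by (metis sets.Diff sets.top)
      have h_\<mu> [measurable]: "h \<in> borel_measurable \<mu>" using h sets_\<mu> by (simp cong: measurable_cong_sets)
      have "(\<integral>\<theta>. h \<theta> \<partial>circle_haar) = (\<integral>\<theta>. - trunc_ln n (w \<theta>) \<partial>circle_haar)"
      proof (rule integral_cong_AE[OF h_haar])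
        show "AE \<theta> in circle_haar. h \<theta> = - trunc_ln n (w \<theta>)"
          using AE_not_in[OF N] by eventually_elim (simp add: h_def)
      qed measurable
      then have int_h: "(\<integral>\<theta>. h \<theta> \<partial>circle_haar) = - (\<integral>\<theta>. trunc_ln n (w \<theta>) \<partial>circle_haar)" by simp
      have "s * exp (\<integral>\<theta>. h \<theta> \<partial>circle_haar) \<le> (\<integral>\<theta>. (cmod (poly 1 (cis \<theta>)))\<^sup>2 * exp (h \<theta>) \<partial>\<mu>)"
        using s by (intro szego_bound_exp_borel[OF \<mu> _ _ h hB]) auto
      then have "ennreal (s * exp (\<integral>\<theta>. h \<theta> \<partial>circle_haar)) \<le> ennreal (\<integral>\<theta>. exp (h \<theta>) \<partial>\<mu>)"
        by (simp add: ennreal_leI)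
      also have "\<dots> = (\<integral>\<^sup>+\<theta>. ennreal (exp (h \<theta>)) \<partial>\<mu>)"
      proof (rule nn_integral_eq_integral[symmetric])
        show "integrable \<mu> (\<lambda>\<theta>. exp (h \<theta>))"
        proof (rule \<mu>.integrable_const_bound[where B = "exp (real n)"])
          show "AE x in \<mu>. norm (exp (h x)) \<le> exp (real n)"
            using hB by (intro AE_I2) (auto simp: abs_le_iff)
        qed measurable
      qed simp
      also have "\<dots> \<le> (\<integral>\<^sup>+\<theta>. ennreal (exp (- real n)) + ennreal (exp (h \<theta>)) * indicator (space \<mu> - N) \<theta> \<partial>\<mu>)"
        by (intro nn_integral_mono) (auto simp: h_def split: split_indicator)
      also have "\<dots> = ennreal (exp (- real n)) * ennreal c + (\<integral>\<^sup>+\<theta>. ennreal (exp (h \<theta>)) * indicator (space \<mu> - N) \<theta> \<partial>\<mu>)"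
        by (subst nn_integral_add) (measurable, simp add: c)
      also have "(\<integral>\<^sup>+\<theta>. ennreal (exp (h \<theta>)) * indicator (space \<mu> - N) \<theta> \<partial>\<mu>)
          = (\<integral>\<^sup>+\<theta>. ennreal (exp (h \<theta>)) \<partial>density \<mu> (indicator (space \<mu> - N)))"
        by (subst nn_integral_density) (measurable, simp add: mult.commute)
      also have "density \<mu> (indicator (space \<mu> - N)) = density (density circle_haar w) (indicator (space \<mu> - N))"
      proof (rule measure_eqI)
        fix A assume "A \<in> sets (density \<mu> (indicator (space \<mu> - N)))"
        then have A: "A \<in> sets circle_borel" by (simp add: sets_\<mu>)
        have eq: "(space \<mu> - N) \<inter> A = A - N"
          using sets.sets_into_space[of A \<mu>] A sets_\<mu> by auto
        have restr: "emeasure (density M (indicator (space \<mu> - N))) A = emeasure M (A - N)"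
          if "sets M = sets circle_borel" for M
        proof -
          have [measurable]: "space \<mu> - N \<in> sets M" "A \<in> sets M"
            using off_N_sets A sets_\<mu> that by auto
          have [measurable]: "A - N \<in> sets M" unfolding eq[symmetric] by measurable
          show ?thesis by (simp add: emeasure_density eq flip: indicator_inter_arith)
        qed
        show "emeasure (density \<mu> (indicator (space \<mu> - N))) A
            = emeasure (density (density circle_haar w) (indicator (space \<mu> - N))) A"
          using off_N[OF A] by (simp add: restr sets_\<mu>)
      qed (simp add: sets_\<mu>)
      also have "(\<integral>\<^sup>+\<theta>. ennreal (exp (h \<theta>)) \<partial>density (density circle_haar w) (indicator (space \<mu> - N)))
          = (\<integral>\<^sup>+\<theta>. w \<theta> * (indicator (space \<mu> - N) \<theta> * ennreal (exp (h \<theta>))) \<partial>circle_haar)"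
      proof -
        have [measurable]: "space \<mu> - N \<in> sets circle_haar" using off_N_sets sets_\<mu> by simp
        show ?thesis by (simp add: nn_integral_density)
      qed
      also have "\<dots> \<le> (\<integral>\<^sup>+\<theta>. 1 + w \<theta> * ennreal (exp (- real n)) \<partial>circle_haar)"
        using mult_exp_minus_trunc_ln_le[of "w _" n]
        by (intro nn_integral_mono) (auto simp: h_def split: split_indicator)
      also have "\<dots> = 1 + (\<integral>\<^sup>+\<theta>. w \<theta> \<partial>circle_haar) * ennreal (exp (- real n))"
        by (simp add: nn_integral_add nn_integral_multc H.emeasure_space_1)
      also have "\<dots> \<le> 1 + ennreal c * ennreal (exp (- real n))"
        by (intro add_left_mono mult_right_mono mass_w) simp
      finally have "ennreal (s * exp (\<integral>\<theta>. h \<theta> \<partial>circle_haar))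
          \<le> ennreal (exp (- real n)) * ennreal c + (1 + ennreal c * ennreal (exp (- real n)))"
        by (simp add: add_left_mono)
      also have "\<dots> = ennreal (1 + 2 * (exp (- real n) * c))"
        by (simp add: c_def mult.commute flip: ennreal_mult ennreal_plus ennreal_1)
      finally have "ennreal (s * exp (\<integral>\<theta>. h \<theta> \<partial>circle_haar)) \<le> ennreal (1 + 2 * (exp (- real n) * c))" .
      moreover have "0 \<le> 1 + 2 * (exp (- real n) * c)" by (simp add: c_def)
      ultimately have "s * exp (- (\<integral>\<theta>. trunc_ln n (w \<theta>) \<partial>circle_haar)) \<le> 1 + 2 * (exp (- real n) * c)"
        unfolding int_h by (simp only: ennreal_le_iff)
      then show ?thesis by (simp add: exp_minus field_simps)
    qed
    moreover have "(\<lambda>n. (1 + 2 * (exp (- real n) * c)) * exp (\<integral>\<theta>. trunc_ln n (w \<theta>) \<partial>circle_haar)) \<longlonglongrightarrow> (1 + 2 * (0 * c)) * L"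
      by (intro tendsto_intros null lim)
    ultimately have "s \<le> (1 + 2 * (0 * c)) * L"
      by (intro LIMSEQ_le_const[of _ _ s]) auto
    then show "s \<le> L" by simp
  qed
qed


section \<open>Rays of the glued tree\<close>

definition glued_ray :: "nat \<Rightarrow> nat \<Rightarrow> (nat \<times> nat) option" where
  "glued_ray i k = (case k of 0 \<Rightarrow> None | Suc n \<Rightarrow> Some (i, n))"

definition depth :: "(nat \<times> nat) option \<Rightarrow> nat" where
  "depth v = (case v of None \<Rightarrow> 0 | Some (i, n) \<Rightarrow> Suc n)"

lemma glued_ray_simps [simp]: "glued_ray i 0 = None" "glued_ray i (Suc n) = Some (i, n)"
  by (simp_all add: glued_ray_def)

lemma depth_simps [simp]: "depth None = 0" "depth (Some (i, n)) = Suc n"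
  by (simp_all add: depth_def)

lemma depth_glued_ray [simp]: "depth (glued_ray i k) = k"
  by (cases k) auto

text \<open>A vertex of a ray is determined by its depth, which turns membership in a ray into an
  equation.\<close>

lemma range_glued_ray: "u \<in> range (glued_ray i) \<longleftrightarrow> glued_ray i (depth u) = u"
  by (metis depth_glued_ray rangeE rangeI)

text \<open>An edge changes the depth by at most one, so no path between two vertices of a
  ray is shorter than the segment of the ray.\<close>

lemma graph_dist_glued_ray:
  assumes i: "i < q" and "m \<le> n"
  shows "graph_dist (glued_rays q) (glued_ray i m) (glued_ray i n) = n - m"
  unfolding graph_dist_def
proof (rule Least_equality)
  let ?E = "edges (glued_rays q)"
  have edge: "(glued_ray i k, glued_ray i (Suc k)) \<in> ?E" for k
    using i by (cases k) (auto simp: glued_rays_simps glued_rays_arcs_def)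
  have "(glued_ray i m, glued_ray i (m + k)) \<in> ?E ^^ k" for k
    by (induction k) (use edge in \<open>auto intro!: relcompI\<close>)
  from this[of "n - m"] show "(glued_ray i m, glued_ray i n) \<in> ?E ^^ (n - m)"
    using \<open>m \<le> n\<close> by simp
next
  let ?E = "edges (glued_rays q)"
  have step: "depth v \<le> Suc (depth u)" if "(u, v) \<in> ?E" for u v
    using that by (auto simp: glued_rays_simps glued_rays_arcs_def)
  have "depth v \<le> depth u + k" if "(u, v) \<in> ?E ^^ k" for u v k
    using that
  proof (induction k arbitrary: v)
    case (Suc k)
    then obtain x where "(u, x) \<in> ?E ^^ k" "(x, v) \<in> ?E" by auto
    with Suc.IH step show ?case by fastforce
  qed simp
  from this[of "glued_ray i m" "glued_ray i n"]
  show "n - m \<le> k" if "(glued_ray i m, glued_ray i n) \<in> ?E ^^ k" for k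
    using that by fastforce
qed

text \<open>The vertex number \<open>n\<close> of a ray has depth \<open>n\<close>, and an edge between vertices other than
  the root does not change the branch.\<close>

lemma rays_glued_rays: "rays (glued_rays q) = glued_ray ` {..<q}"
proof (intro equalityI subsetI)
  fix \<xi> assume "\<xi> \<in> glued_ray ` {..<q}"
  then obtain i where i: "i < q" and \<xi>: "\<xi> = glued_ray i" by auto
  have "glued_ray i k \<in> verts (glued_rays q)" for k
    using i by (cases k) (auto simp: glued_rays_simps)
  then show "\<xi> \<in> rays (glued_rays q)"
    using graph_dist_glued_ray[OF i] by (auto simp: rays_def \<xi> glued_rays_simps)
next
  fix \<xi> assume "\<xi> \<in> rays (glued_rays q)"
  then have root: "\<xi> 0 = None" and verts: "\<And>n. \<xi> n \<in> verts (glued_rays q)"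
    and dist: "\<And>m n. m \<le> n \<Longrightarrow> graph_dist (glued_rays q) (\<xi> m) (\<xi> n) = n - m"
    by (auto simp: rays_def glued_rays_simps)
  have depth: "depth (\<xi> n) = n" for n
  proof (cases "\<xi> n")
    case None
    then show ?thesis using dist[of 0 n] root graph_dist_root_glued_rays(1)[of q] by simp
  next
    case (Some p)
    then obtain i k where p: "\<xi> n = Some (i, k)" "i < q"
      using verts[of n] by (cases p) (auto simp: glued_rays_simps)
    then show ?thesis using dist[of 0 n] root graph_dist_root_glued_rays(2)[of i q k] by simp
  qed
  obtain i where i: "\<xi> 1 = Some (i, 0)" "i < q"
    using verts[of 1] depth[of 1] by (auto simp: glued_rays_simps)
  have edge: "(\<xi> n, \<xi> (Suc n)) \<in> edges (glued_rays q)" for n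
  proof -
    have "(\<xi> n, \<xi> (Suc n)) \<in> (edges (glued_rays q))\<^sup>*"
      using rooted_tree_glued_rays[of q] verts unfolding rooted_tree_def by blast
    then obtain k where "(\<xi> n, \<xi> (Suc n)) \<in> edges (glued_rays q) ^^ k"
      by (auto simp: rtrancl_power)
    then have "(\<xi> n, \<xi> (Suc n)) \<in> edges (glued_rays q) ^^ graph_dist (glued_rays q) (\<xi> n) (\<xi> (Suc n))"
      unfolding graph_dist_def by (rule LeastI)
    then show ?thesis using dist[of n "Suc n"] by simp
  qed
  have "\<xi> (Suc n) = Some (i, n)" for n
  proof (induction n)
    case (Suc n)
    then show ?case using edge[of "Suc n"] depth[of "Suc (Suc n)"]
      by (auto simp: glued_rays_simps glued_rays_arcs_def)
  qed (use i in simp)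
  then have "\<xi> = glued_ray i" using root by (intro ext) (case_tac x, auto)
  then show "\<xi> \<in> glued_ray ` {..<q}" using i by auto
qed

lemma comparable_glued_rays:
  "comparable (glued_rays q) u v \<longleftrightarrow> (\<exists>i<q. u \<in> range (glued_ray i) \<and> v \<in> range (glued_ray i))"
  by (auto simp: comparable_def rays_glued_rays)


section \<open>The covariance kernel of a branching-type process\<close>

text \<open>The Gram matrix of \<open>1, z, z\<^sup>2, \<dots>\<close> in \<open>L\<^sup>2(\<mu>)\<close> along each ray, and zero for
  non-comparable vertices.  Vertices outside the tree are comparable to none, so the kernel
  vanishes there.\<close>

definition branching_kernel :: "nat \<Rightarrow> real measure \<Rightarrow> (nat \<times> nat) option \<Rightarrow> (nat \<times> nat) option \<Rightarrow> complex" where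
  "branching_kernel q \<mu> u v = (if comparable (glued_rays q) u v
     then \<integral>\<theta>. cis \<theta> ^ depth u * cnj (cis \<theta> ^ depth v) \<partial>\<mu> else 0)"

text \<open>The powers \<open>z\<^sup>n\<close> form a stationary sequence in \<open>L\<^sup>2\<close>: the right-hand side, whose integral is the
  covariance of \<open>z\<^sup>n\<close> and \<open>z\<^sup>n\<^sup>+\<^sup>k\<close>, is the same for all \<open>n\<close>.\<close>

lemma exp_eq_cis_power:
  "exp (- \<i> * of_nat k * of_real \<theta>) = cis \<theta> ^ n * cnj (cis \<theta> ^ (n + k))"
  unfolding Complex.DeMoivre cis_cnj cis_mult unfolding cis_conv_exp by (simp add: algebra_simps)

lemma branching_kernel_commute: "branching_kernel q \<mu> v u = cnj (branching_kernel q \<mu> u v)"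
proof -
  have "(\<integral>\<theta>. cis \<theta> ^ depth v * cnj (cis \<theta> ^ depth u) \<partial>\<mu>) = cnj (\<integral>\<theta>. cis \<theta> ^ depth u * cnj (cis \<theta> ^ depth v) \<partial>\<mu>)"
    using Bochner_Integration.integral_cnj[of \<mu> "\<lambda>\<theta>. cis \<theta> ^ depth u * cnj (cis \<theta> ^ depth v)"] by (simp add: mult.commute)
  moreover have "comparable (glued_rays q) v u \<longleftrightarrow> comparable (glued_rays q) u v"
    by (auto simp: comparable_def)
  ultimately show ?thesis by (simp add: branching_kernel_def)
qed

text \<open>Apart from mean zero and square integrability, the conditions on the process concern
  covariances alone.  Stationarity
  only prescribes covariances of an earlier with a later vertex; the remaining ones follow by
  conjugation.\<close>

lemma is_process_spectral_measure_iff_cov: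
  assumes \<mu>: "circle_measure \<mu>" and q: "0 < q"
  shows "is_process_spectral_measure M (glued_rays q) X \<mu> \<longleftrightarrow>
    mean_zero_L2_process M (verts (glued_rays q)) X \<and>
    (\<forall>u \<in> verts (glued_rays q). \<forall>v \<in> verts (glued_rays q). cov M (X u) (X v) = branching_kernel q \<mu> u v)"
    (is "?L \<longleftrightarrow> ?L2 \<and> ?C")
proof
  assume L: ?L
  then have L2: ?L2 and spec: "\<And>i. i < q \<Longrightarrow> is_spectral_measure M (\<lambda>n. X (glued_ray i n)) \<mu>"
    and zero: "\<And>u v. u \<in> verts (glued_rays q) \<Longrightarrow> v \<in> verts (glued_rays q) \<Longrightarrow>
      \<not> comparable (glued_rays q) u v \<Longrightarrow> cov M (X u) (X v) = 0"
    by (auto simp: is_process_spectral_measure_def branching_type_stationary_def rays_glued_rays)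
  have le: "cov M (X u) (X v) = branching_kernel q \<mu> u v"
    if c: "comparable (glued_rays q) u v" and "depth u \<le> depth v" for u v
  proof -
    obtain i where i: "i < q" "glued_ray i (depth u) = u" "glued_ray i (depth v) = v"
      using c by (auto simp: comparable_glued_rays range_glued_ray)
    define k where "k = depth v - depth u"
    have v: "depth v = depth u + k" using that by (simp add: k_def)
    have "cov M (X (glued_ray i (depth u))) (X (glued_ray i (depth u + k))) = (\<integral>\<theta>. exp (- \<i> * of_nat k * of_real \<theta>) \<partial>\<mu>)"
      using spec[OF i(1)] by (simp add: is_spectral_measure_def)
    also have "\<dots> = branching_kernel q \<mu> u v"
      unfolding branching_kernel_def exp_eq_cis_power[of k _ "depth u"] v using c by simp
    finally show ?thesis using i(2,3) v by simp
  qed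
  have "cov M (X u) (X v) = branching_kernel q \<mu> u v" if c: "comparable (glued_rays q) u v" for u v
  proof (cases "depth u \<le> depth v")
    case False
    have "comparable (glued_rays q) v u" using c by (auto simp: comparable_def)
    then have "cov M (X v) (X u) = branching_kernel q \<mu> v u" using False by (intro le) auto
    then show ?thesis by (subst cov_commute, subst branching_kernel_commute) simp
  qed (rule le[OF c])
  with L2 zero show "?L2 \<and> ?C" by (auto simp: branching_kernel_def)
next
  assume R: "?L2 \<and> ?C"
  have verts: "glued_ray i k \<in> verts (glued_rays q)" if "i < q" for i k
    using that by (cases k) (auto simp: glued_rays_simps)
  have cov: "cov M (X (glued_ray i n)) (X (glued_ray i (n + k))) = (\<integral>\<theta>. exp (- \<i> * of_nat k * of_real \<theta>) \<partial>\<mu>)"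
    if "i < q" for i n k
  proof -
    have "comparable (glued_rays q) (glued_ray i n) (glued_ray i (n + k))"
      using that by (auto simp: comparable_glued_rays)
    then show ?thesis
      unfolding exp_eq_cis_power[of k _ n]
      using R verts[OF that] by (simp add: branching_kernel_def)
  qed
  have "is_spectral_measure M (\<lambda>n. X (glued_ray i n)) \<mu>" if "i < q" for i
    using cov[OF that] \<mu> by (simp add: is_spectral_measure_def)
  moreover have "stationary M (\<lambda>n. X (glued_ray i n))" if "i < q" for i
    using cov[OF that] R verts[OF that] by (simp add: stationary_def mean_zero_L2_process_def)
  moreover have "cov M (X u) (X v) = 0" if "u \<in> verts (glued_rays q)" "v \<in> verts (glued_rays q)"
      "\<not> comparable (glued_rays q) u v" for u v
    using R that by (simp add: branching_kernel_def)
  ultimately show ?L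
    using R by (auto simp: is_process_spectral_measure_def branching_type_stationary_def rays_glued_rays)
qed

lemma spectral_measure_iff_psd_kernel:
  assumes \<mu>: "circle_measure \<mu>" and q: "0 < q"
  shows "spectral_measure_of_branching_process (glued_rays q) \<mu> \<longleftrightarrow> psd_kernel (branching_kernel q \<mu>)"
proof
  let ?V = "verts (glued_rays q)"
  assume "spectral_measure_of_branching_process (glued_rays q) \<mu>"
  then obtain M :: "((nat \<times> nat) option \<Rightarrow> complex) measure" and X
    where X: "mean_zero_L2_process M ?V X"
      and cov: "\<And>u v. u \<in> ?V \<Longrightarrow> v \<in> ?V \<Longrightarrow> cov M (X u) (X v) = branching_kernel q \<mu> u v"
    unfolding spectral_measure_of_branching_process_def is_process_spectral_measure_iff_cov[OF \<mu> q] by auto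
  have outside: "branching_kernel q \<mu> u v = 0" if "u \<notin> ?V \<or> v \<notin> ?V" for u v
    using that by (auto simp: branching_kernel_def comparable_def rays_def)
  show "psd_kernel (branching_kernel q \<mu>)"
    unfolding psd_kernel_def
  proof (intro conjI allI impI)
    fix S :: "(nat \<times> nat) option set" and a :: "(nat \<times> nat) option \<Rightarrow> complex" assume S: "finite S"
    have "(\<Sum>u\<in>S. \<Sum>v\<in>S. a u * cnj (a v) * branching_kernel q \<mu> u v)
        = (\<Sum>u\<in>S \<inter> ?V. \<Sum>v\<in>S \<inter> ?V. a u * cnj (a v) * branching_kernel q \<mu> u v)"
      using S by (intro sum.mono_neutral_cong_right) (auto simp: outside intro!: sum.mono_neutral_right sum.neutral)
    also have "\<dots> = (\<Sum>u\<in>S \<inter> ?V. \<Sum>v\<in>S \<inter> ?V. a u * cnj (a v) * cov M (X u) (X v))"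
      by (intro sum.cong refl) (simp add: cov)
    finally show "0 \<le> Re (\<Sum>u\<in>S. \<Sum>v\<in>S. a u * cnj (a v) * branching_kernel q \<mu> u v)"
      using cov_form_nonneg[OF X, of "S \<inter> ?V" a] S by simp
  qed (rule branching_kernel_commute)
next
  assume "psd_kernel (branching_kernel q \<mu>)"
  then obtain X :: "(nat \<times> nat) option \<Rightarrow> real \<Rightarrow> complex"
    where X: "mean_zero_L2_process circle_haar UNIV X" "\<And>u v. cov circle_haar (X u) (X v) = branching_kernel q \<mu> u v"
    using psd_kernel_covariance_countable by blast
  have "is_process_spectral_measure circle_haar (glued_rays q) X \<mu>"
    unfolding is_process_spectral_measure_iff_cov[OF \<mu> q] using X by (simp add: mean_zero_L2_process_def)
  then show "spectral_measure_of_branching_process (glued_rays q) \<mu>"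
    by (rule spectral_measure_of_branching_processI)
qed


section \<open>Positivity of the kernel as an extremal problem\<close>

text \<open>A pair of comparable vertices lies on exactly one ray, except that the pair of the
  root with itself lies on all \<open>q\<close> of them and is counted \<open>q - 1\<close> times too often.\<close>

lemma branching_kernel_eq_sum:
  assumes \<mu>: "circle_measure \<mu>" and q: "0 < q"
  shows "branching_kernel q \<mu> u v =
    (\<Sum>i<q. indicator (range (glued_ray i)) u * indicator (range (glued_ray i)) v *
        (\<integral>\<theta>. cis \<theta> ^ depth u * cnj (cis \<theta> ^ depth v) \<partial>\<mu>))
    - of_real ((real q - 1) * measure \<mu> (space \<mu>)) * (indicator {None} u * indicator {None} v)"
proof -
  let ?I = "\<integral>\<theta>. cis \<theta> ^ depth u * cnj (cis \<theta> ^ depth v) \<partial>\<mu>"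
  have root: "None \<in> range (glued_ray i)" for i by (simp add: range_glued_ray)
  show ?thesis
  proof (cases "u = None \<and> v = None")
    case True
    then show ?thesis using q root
      by (auto simp: branching_kernel_def comparable_glued_rays scaleR_conv_of_real algebra_simps)
  next
    case False
    then obtain w k n where w: "w = Some (k, n)" "w = u \<or> w = v" by (cases u; cases v; force)
    have eq_k: "i = k" if "u \<in> range (glued_ray i)" "v \<in> range (glued_ray i)" for i
      using that w by (auto simp: range_glued_ray)
    have comp: "comparable (glued_rays q) u v \<longleftrightarrow> k < q \<and> u \<in> range (glued_ray k) \<and> v \<in> range (glued_ray k)"
      unfolding comparable_glued_rays using eq_k by blast
    have "(\<Sum>i<q. indicator (range (glued_ray i)) u * indicator (range (glued_ray i)) v * ?I)
       = (\<Sum>i<q. if i = k then indicator (range (glued_ray k)) u * indicator (range (glued_ray k)) v * ?I else 0)"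
    proof (intro sum.cong refl)
      fix i
      show "indicator (range (glued_ray i)) u * indicator (range (glued_ray i)) v * ?I
        = (if i = k then indicator (range (glued_ray k)) u * indicator (range (glued_ray k)) v * ?I else 0)"
        using eq_k[of i] by (cases "i = k") (auto simp: indicator_def)
    qed
    also have "\<dots> = (if k < q then indicator (range (glued_ray k)) u * indicator (range (glued_ray k)) v * ?I else 0)"
      by simp
    also have "\<dots> = branching_kernel q \<mu> u v"
      unfolding branching_kernel_def comp by (simp add: indicator_def)
    finally show ?thesis using False by auto
  qed
qed

text \<open>The polynomial that coefficients on the vertex set \<open>S\<close> induce on ray \<open>i\<close>, the depth
  being the exponent.\<close>

definition ray_poly :: "(nat \<times> nat) option set \<Rightarrow> ((nat \<times> nat) option \<Rightarrow> complex) \<Rightarrow> nat \<Rightarrow> complex poly" where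
  "ray_poly S a i = (\<Sum>u\<in>S. monom (indicator (range (glued_ray i)) u * a u) (depth u))"

lemma poly_ray_poly:
  "poly (ray_poly S a i) z = (\<Sum>u\<in>S. indicator (range (glued_ray i)) u * a u * z ^ depth u)"
  by (simp add: ray_poly_def poly_sum poly_monom)

lemma poly_ray_poly_0:
  assumes "finite S"
  shows "poly (ray_poly S a i) 0 = (\<Sum>u\<in>S. indicator {None} u * a u)"
proof -
  have "indicator (range (glued_ray i)) u * a u * 0 ^ depth u = indicator {None} u * a u" for u
    by (cases u) (auto simp: range_glued_ray split: split_indicator)
  then show ?thesis unfolding poly_ray_poly by (simp only:)
qed

text \<open>Summation over the rays as in \<open>branching_kernel_eq_sum\<close> turns the form into a sum of squared
  norms of polynomials; the correction term involves the coefficient of the root alone.\<close>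

lemma branching_kernel_form:
  assumes \<mu>: "circle_measure \<mu>" and q: "0 < q" and S: "finite S"
  shows "Re (\<Sum>u\<in>S. \<Sum>v\<in>S. a u * cnj (a v) * branching_kernel q \<mu> u v) =
    (\<Sum>i<q. \<integral>\<theta>. (cmod (poly (ray_poly S a i) (cis \<theta>)))\<^sup>2 \<partial>\<mu>)
    - (real q - 1) * measure \<mu> (space \<mu>) * (cmod (\<Sum>u\<in>S. indicator {None} u * a u))\<^sup>2"
proof -
  let ?e = "\<lambda>i u. indicator (range (glued_ray i)) u :: complex"
  let ?n = "\<lambda>u. indicator {None} u :: complex"
  let ?I = "\<lambda>u v. \<integral>\<theta>. cis \<theta> ^ depth u * cnj (cis \<theta> ^ depth v) \<partial>\<mu>"
  have int: "integrable \<mu> (\<lambda>\<theta>. cis \<theta> ^ k * cnj (cis \<theta> ^ l))" for k l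
    by (rule circle_measure_integrable_continuous[OF \<mu>]) (intro continuous_intros)
  have ray: "(\<Sum>u\<in>S. \<Sum>v\<in>S. a u * cnj (a v) * (?e i u * ?e i v * ?I u v))
     = of_real (\<integral>\<theta>. (cmod (poly (ray_poly S a i) (cis \<theta>)))\<^sup>2 \<partial>\<mu>)" for i
  proof -
    have "(\<Sum>u\<in>S. \<Sum>v\<in>S. a u * cnj (a v) * (?e i u * ?e i v * ?I u v))
       = (\<integral>\<theta>. (\<Sum>u\<in>S. \<Sum>v\<in>S. a u * cnj (a v) * (?e i u * ?e i v) * (cis \<theta> ^ depth u * cnj (cis \<theta> ^ depth v))) \<partial>\<mu>)"
      using int by (simp add: Bochner_Integration.integral_sum mult.assoc del: complex_cnj_power)
    also have "\<dots> = (\<integral>\<theta>. of_real ((cmod (poly (ray_poly S a i) (cis \<theta>)))\<^sup>2) \<partial>\<mu>)"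
    proof (rule Bochner_Integration.integral_cong[OF refl])
      have cnj_e: "cnj (?e i u) = ?e i u" for u by (simp split: split_indicator)
      show "(\<Sum>u\<in>S. \<Sum>v\<in>S. a u * cnj (a v) * (?e i u * ?e i v) * (cis \<theta> ^ depth u * cnj (cis \<theta> ^ depth v)))
          = of_real ((cmod (poly (ray_poly S a i) (cis \<theta>)))\<^sup>2)" for \<theta>
        unfolding complex_norm_square poly_ray_poly cnj_sum sum_product complex_cnj_mult cnj_e
        by (intro sum.cong refl) (simp only: mult_ac)
    qed
    also have "\<dots> = of_real (\<integral>\<theta>. (cmod (poly (ray_poly S a i) (cis \<theta>)))\<^sup>2 \<partial>\<mu>)"
      by (rule integral_complex_of_real)
    finally show ?thesis .
  qed
  have rt: "(\<Sum>u\<in>S. \<Sum>v\<in>S. a u * cnj (a v) * (c * (?n u * ?n v)))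
      = c * of_real ((cmod (\<Sum>u\<in>S. ?n u * a u))\<^sup>2)" for c
  proof -
    have cnj_n: "cnj (?n u) = ?n u" for u by (simp split: split_indicator)
    have "complex_of_real ((cmod (\<Sum>u\<in>S. ?n u * a u))\<^sup>2) = (\<Sum>u\<in>S. \<Sum>v\<in>S. ?n u * a u * (?n v * cnj (a v)))"
      unfolding complex_norm_square cnj_sum sum_product complex_cnj_mult cnj_n ..
    then show ?thesis
      by (simp only: sum_distrib_left) (intro sum.cong refl, simp only: mult_ac)
  qed
  have "(\<Sum>u\<in>S. \<Sum>v\<in>S. a u * cnj (a v) * branching_kernel q \<mu> u v)
    = (\<Sum>u\<in>S. \<Sum>v\<in>S. \<Sum>i<q. a u * cnj (a v) * (?e i u * ?e i v * ?I u v))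
     - (\<Sum>u\<in>S. \<Sum>v\<in>S. a u * cnj (a v) * (of_real ((real q - 1) * measure \<mu> (space \<mu>)) * (?n u * ?n v)))"
    unfolding branching_kernel_eq_sum[OF \<mu> q] right_diff_distrib sum_subtractf sum_distrib_left ..
  also have "(\<Sum>u\<in>S. \<Sum>v\<in>S. \<Sum>i<q. a u * cnj (a v) * (?e i u * ?e i v * ?I u v))
    = (\<Sum>i<q. \<Sum>u\<in>S. \<Sum>v\<in>S. a u * cnj (a v) * (?e i u * ?e i v * ?I u v))"
    by (subst sum.swap, subst (2) sum.swap, rule refl)
  finally show ?thesis unfolding ray rt by (simp flip: of_real_mult of_real_diff of_real_sum)
qed

text \<open>In one direction the coefficients of a single polynomial are copied to all
  rays.  In the other direction the bound is applied to the polynomial of each ray, after scaling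
  its constant term to \<open>1\<close>; if the constant term is \<open>0\<close>, the bound is trivial.\<close>

lemma psd_branching_kernel_iff:
  assumes \<mu>: "circle_measure \<mu>" and q: "0 < q"
  shows "psd_kernel (branching_kernel q \<mu>) \<longleftrightarrow>
    (\<forall>P. poly P 0 = 1 \<longrightarrow> (1 - 1 / real q) * measure \<mu> (space \<mu>) \<le> (\<integral>\<theta>. (cmod (poly P (cis \<theta>)))\<^sup>2 \<partial>\<mu>))"
    (is "?L \<longleftrightarrow> ?R")
proof
  assume L: ?L
  show ?R
  proof (intro allI impI)
    fix P :: "complex poly" assume P: "poly P 0 = 1"
    \<comment> \<open>the coefficient at depth \<open>k\<close> is that of \<open>P\<close> on every ray\<close>
    define S where "S = (\<Union>i<q. glued_ray i ` {..degree P})"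
    define a where "a u = coeff P (depth u)" for u :: "(nat \<times> nat) option"
    have S: "finite S" by (simp add: S_def)
    have ray: "poly (ray_poly S a i) z = poly P z" if i: "i < q" for i z
    proof -
      have "poly (ray_poly S a i) z = (\<Sum>u\<in>glued_ray i ` {..degree P}. indicator (range (glued_ray i)) u * a u * z ^ depth u)"
        unfolding poly_ray_poly
      proof (intro sum.mono_neutral_right S ballI)
        show "glued_ray i ` {..degree P} \<subseteq> S" using i by (auto simp: S_def)
        fix u assume u: "u \<in> S - glued_ray i ` {..degree P}"
        then obtain j k where "u = glued_ray j k" "k \<le> degree P" by (auto simp: S_def)
        then have "depth u \<le> degree P" by simp
        then have "glued_ray i (depth u) \<noteq> u" using u by force
        then show "indicator (range (glued_ray i)) u * a u * z ^ depth u = 0"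
          by (simp add: indicator_def range_glued_ray)
      qed
      also have "\<dots> = (\<Sum>k\<le>degree P. coeff P k * z ^ k)"
        by (subst sum.reindex) (auto simp: a_def intro: inj_on_inverseI[of _ depth])
      also have "\<dots> = poly P z" by (simp add: poly_altdef)
      finally show ?thesis .
    qed
    have "(\<Sum>u\<in>S. indicator {None} u * a u) = 1"
      using poly_ray_poly_0[OF S, of a 0] ray[OF q] P by simp
    then have "0 \<le> (\<Sum>i<q. \<integral>\<theta>. (cmod (poly (ray_poly S a i) (cis \<theta>)))\<^sup>2 \<partial>\<mu>) - (real q - 1) * measure \<mu> (space \<mu>)"
      using psd_kernel_form[OF L S, of a] unfolding branching_kernel_form[OF \<mu> q S] by simp
    then have "(real q - 1) * measure \<mu> (space \<mu>) \<le> real q * (\<integral>\<theta>. (cmod (poly P (cis \<theta>)))\<^sup>2 \<partial>\<mu>)"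
      by (simp add: ray)
    then show "(1 - 1 / real q) * measure \<mu> (space \<mu>) \<le> (\<integral>\<theta>. (cmod (poly P (cis \<theta>)))\<^sup>2 \<partial>\<mu>)"
      using q by (simp add: field_simps)
  qed
next
  assume R: ?R
  let ?s = "(1 - 1 / real q) * measure \<mu> (space \<mu>)"
  have homogeneous: "?s * (cmod (poly P 0))\<^sup>2 \<le> (\<integral>\<theta>. (cmod (poly P (cis \<theta>)))\<^sup>2 \<partial>\<mu>)" for P
  proof (cases "poly P 0 = 0")
    case False
    define Q where "Q = smult (inverse (poly P 0)) P"
    have "?s \<le> (\<integral>\<theta>. (cmod (poly Q (cis \<theta>)))\<^sup>2 \<partial>\<mu>)"
    proof (rule R[rule_format])
      show "poly Q 0 = 1" using False by (simp add: Q_def)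
    qed
    also have "\<dots> = (\<integral>\<theta>. (cmod (poly P (cis \<theta>)))\<^sup>2 / (cmod (poly P 0))\<^sup>2 \<partial>\<mu>)"
      by (simp add: Q_def norm_mult norm_inverse power_mult_distrib divide_inverse mult.commute power_inverse)
    also have "\<dots> = (\<integral>\<theta>. (cmod (poly P (cis \<theta>)))\<^sup>2 \<partial>\<mu>) / (cmod (poly P 0))\<^sup>2" by simp
    finally show ?thesis using False by (simp add: pos_le_divide_eq)
  qed simp
  show ?L
    unfolding psd_kernel_def
  proof (intro conjI allI impI)
    fix S :: "(nat \<times> nat) option set" and a :: "(nat \<times> nat) option \<Rightarrow> complex" assume S: "finite S"
    let ?r = "(cmod (\<Sum>u\<in>S. indicator {None} u * a u))\<^sup>2"
    have "(real q - 1) * measure \<mu> (space \<mu>) * ?r = (\<Sum>i<q. ?s * ?r)"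
      using q by (simp add: field_simps)
    also have "\<dots> \<le> (\<Sum>i<q. \<integral>\<theta>. (cmod (poly (ray_poly S a i) (cis \<theta>)))\<^sup>2 \<partial>\<mu>)"
    proof (rule sum_mono)
      show "?s * ?r \<le> (\<integral>\<theta>. (cmod (poly (ray_poly S a i) (cis \<theta>)))\<^sup>2 \<partial>\<mu>)" for i
        using homogeneous[of "ray_poly S a i"] unfolding poly_ray_poly_0[OF S] .
    qed
    finally show "0 \<le> Re (\<Sum>u\<in>S. \<Sum>v\<in>S. a u * cnj (a v) * branching_kernel q \<mu> u v)"
      unfolding branching_kernel_form[OF \<mu> q S] by simp
  qed (rule branching_kernel_commute)
qed

theorem theorem1p5:
  fixes q :: nat and \<mu> :: "real measure"
  assumes "q \<ge> 2" and "circle_measure \<mu>"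
  shows "spectral_measure_of_branching_process (glued_rays q) \<mu> \<longleftrightarrow>
    exp_ereal (ereal_integral circle_haar
        (\<lambda>\<theta>. ln_ennreal (RN_deriv circle_haar (ac_part circle_haar \<mu>) \<theta>)))
      \<ge> ereal ((1 - 1 / real q) * measure \<mu> (space \<mu>))"
proof -
  have q: "0 < q" using assms(1) by simp
  show ?thesis
    unfolding spectral_measure_iff_psd_kernel[OF assms(2) q] psd_branching_kernel_iff[OF assms(2) q]
    by (rule szego[OF assms(2)])
qed

end
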